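(* Let $2<\alpha\le 3$, $\eta\in(0,1)$, $\mu\ge 0$, $\beta\ge 0$, and let $A:[0,1]\to\mathbb{R}$ be a function of bounded variation. Put $\gamma[u]=\int_0^1 u(s)\,dA(s)$ for $u\in C[0,1]$ and $\Lambda=\mu\eta+\beta\int_0^1 t\,dA(t)$. Assume $0\le\Lambda<1$ and $g_A(s)\ge 0$ for all $s\in[0,1]$, where $g_A$ is defined in the context. Let $\tau_1,\tau_2$ be the constants $$\tau_1=\frac{\eta-\eta^{\alpha-1}}{1-\Lambda}\int_0^1 (s-s^{\alpha-1})\Big(\beta g_A(s)+(\mu-\Lambda+1)\Psi(s)\Big)ds,\qquad \tau_2=\frac{1}{1-\Lambda}\Big(\beta\int_0^1 g_A(s)\,ds+\frac{\mu-\Lambda+1}{\Gamma(\alpha+1)}\Big),$$ where $\Psi(s)=\frac{(1-s)^{\alpha-1}}{\Gamma(\alpha)}$. Let $f:[0,1]\times[0,\infty)\to[0,\infty)$ be continuous and suppose that: (C1) there exist $a\in(0,\tau_2^{-1})$ and $c>0$ such that $f(t,x)\le ax+c$ for all $(t,x)\in[0,1]\times[0,\infty)$; (C2) there exist $b\in[\tau_1^{-1},\infty)$ and $\delta>0$ such that $f(t,x)\ge bx$ for all $(t,x)\in[0,1]\times[0,\delta]$. Then the boundary value problem $$D^\alpha u(t)+f(t,u(t))=0,\quad t\in(0,1),\qquad u(0)=u''(0)=0,\quad u(1)=\mu u(\eta)+\beta\gamma[u],$$ where $D^\alpha$ is the Caputo fractional derivative of order $\alpha$, has at least one positive solution.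
   Context: Integrals against $dA$ are Riemann–Stieltjes integrals; $A$ is not assumed monotone. Define $$\mathcal{G}(t,s)=\frac{1}{\Gamma(\alpha)}\begin{cases} t(1-s)^{\alpha-1}-(t-s)^{\alpha-1}, & 0\le s\le t\le 1,\\ t(1-s)^{\alpha-1}, & 0\le t\le s\le 1,\end{cases}\qquad g_A(s)=\int_0^1\mathcal{G}(t,s)\,dA(t).$$ Caputo derivative: for $2<\alpha\le3$, the Riemann–Liouville fractional integral is $I^{\nu}v(t)=\frac{1}{\Gamma(\nu)}\int_0^t (t-s)^{\nu-1}v(s)\,ds$ for $\nu>0$, and $I^0v=v$. For $u\in C^2[0,1]$, $D^\alpha u(t)=\frac{d}{dt}\,I^{3-\alpha}\big(u''-u''(0)\big)(t)$ whenever this derivative exists. For $2<\alpha<3$ and $u\in C^3$ this equals $\frac{1}{\Gamma(3-\alpha)}\int_0^t (t-s)^{2-\alpha}u'''(s)\,ds$, and for $\alpha=3$ it equals $u'''$. A solution is a function $u\in C^2[0,1]$ such that $D^\alpha u(t)$ exists for $t\in(0,1)$ and the equation and boundary conditions hold. A positive solution is a solution $u$ with $u(t)\ge 0$ for all $t\in[0,1]$ and $u$ not identically zero (the paper identifies positive solutions with nontrivial fixed points, in the cone of nonnegative continuous functions, of the associated integral operator). *)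

theory Defs
  imports "HOL-Analysis.Analysis"
begin

subsection \<open>Bounded variation and the Riemann--Stieltjes integral\<close>

definition bounded_variation_on :: "(real \<Rightarrow> real) \<Rightarrow> real \<Rightarrow> real \<Rightarrow> bool" where
  "bounded_variation_on A a b \<longleftrightarrow>
     (\<exists>B. \<forall>D. D division_of {a..b} \<longrightarrow> (\<Sum>K\<in>D. \<bar>A (Sup K) - A (Inf K)\<bar>) \<le> B)"

text \<open>The limit is taken as the mesh tends to zero. Each cell \<open>K\<close> of a tagged division is a
  compact interval with end points \<open>Inf K\<close> and \<open>Sup K\<close>; one-point cells contribute nothing.\<close>

definition has_rs_integral ::
    "(real \<Rightarrow> real) \<Rightarrow> (real \<Rightarrow> real) \<Rightarrow> real \<Rightarrow> real \<Rightarrow> real \<Rightarrow> bool" where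
  "has_rs_integral f A a b I \<longleftrightarrow>
     (\<forall>\<epsilon>>0. \<exists>\<delta>>0. \<forall>p. p tagged_division_of {a..b} \<longrightarrow> (\<forall>(x, K)\<in>p. Sup K - Inf K < \<delta>) \<longrightarrow>
        \<bar>(\<Sum>(x, K)\<in>p. f x * (A (Sup K) - A (Inf K))) - I\<bar> < \<epsilon>)"

definition rs_integral :: "(real \<Rightarrow> real) \<Rightarrow> (real \<Rightarrow> real) \<Rightarrow> real \<Rightarrow> real \<Rightarrow> real" where
  "rs_integral f A a b = (THE I. has_rs_integral f A a b I)"

lemma has_rs_integral_unique:
  assumes I: "has_rs_integral f A a b I" and J: "has_rs_integral f A a b J"
  shows "I = J"
proof (rule ccontr)
  assume "I \<noteq> J"
  then have e: "\<bar>I - J\<bar> / 2 > 0" by simp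
  obtain d1 where d1: "d1 > 0"
    "\<And>p. p tagged_division_of {a..b} \<Longrightarrow> \<forall>(x, K)\<in>p. Sup K - Inf K < d1 \<Longrightarrow>
        \<bar>(\<Sum>(x, K)\<in>p. f x * (A (Sup K) - A (Inf K))) - I\<bar> < \<bar>I - J\<bar> / 2"
    using I e unfolding has_rs_integral_def by meson
  obtain d2 where d2: "d2 > 0"
    "\<And>p. p tagged_division_of {a..b} \<Longrightarrow> \<forall>(x, K)\<in>p. Sup K - Inf K < d2 \<Longrightarrow>
        \<bar>(\<Sum>(x, K)\<in>p. f x * (A (Sup K) - A (Inf K))) - J\<bar> < \<bar>I - J\<bar> / 2"
    using J e unfolding has_rs_integral_def by meson
  define d where "d = min d1 d2 / 3"
  have "d > 0" using d1(1) d2(1) by (simp add: d_def)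
  then have "gauge (\<lambda>x::real. ball x d)" by (simp add: gauge_def)
  then obtain p where p: "p tagged_division_of {a..b}" "(\<lambda>x. ball x d) fine p"
    by (rule fine_division_exists_real)
  have "Sup K - Inf K < min d1 d2" if xK: "(x, K) \<in> p" for x K
  proof -
    have "x \<in> K" by (rule tagged_division_ofD(2)[OF p(1) xK])
    obtain u v where K: "K = {u..v}"
      using tagged_division_ofD(4)[OF p(1) xK] by auto
    with \<open>x \<in> K\<close> have "u \<le> v" by auto
    moreover have "K \<subseteq> ball x d" using p(2) xK by (auto simp: fine_def)
    ultimately have "u \<in> ball x d" "v \<in> ball x d" using K by auto
    then have "v - u < 2 * d" by (auto simp: dist_real_def)
    then have "v - u < 3 * d" using \<open>d > 0\<close> by linarith
    then show ?thesis using K \<open>u \<le> v\<close> by (simp add: d_def)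
  qed
  then have "\<forall>(x, K)\<in>p. Sup K - Inf K < d1" "\<forall>(x, K)\<in>p. Sup K - Inf K < d2"
    by fastforce+
  from d1(2)[OF p(1) this(1)] d2(2)[OF p(1) this(2)]
  obtain S where "\<bar>S - I\<bar> < \<bar>I - J\<bar> / 2" "\<bar>S - J\<bar> < \<bar>I - J\<bar> / 2"
    by blast
  then show False by (simp add: abs_if split: if_splits)
qed

lemma rs_integral_unique: "has_rs_integral f A a b I \<Longrightarrow> rs_integral f A a b = I"
  unfolding rs_integral_def by (blast intro: has_rs_integral_unique)


subsection \<open>The Caputo derivative\<close>

definition rl_integral :: "real \<Rightarrow> (real \<Rightarrow> real) \<Rightarrow> real \<Rightarrow> real" where
  "rl_integral \<nu> v t =
     (if \<nu> = 0 then v t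
      else 1 / Gamma \<nu> * integral {0..t} (\<lambda>s. (t - s) powr (\<nu> - 1) * v s))"

text \<open>Derivatives on \<open>[0, 1]\<close> are one-sided at the end points.\<close>

definition deriv01 :: "(real \<Rightarrow> real) \<Rightarrow> real \<Rightarrow> real" where
  "deriv01 u t = vector_derivative u (at t within {0..1})"

definition C2_on01 :: "(real \<Rightarrow> real) \<Rightarrow> bool" where
  "C2_on01 u \<longleftrightarrow> u differentiable_on {0..1} \<and> deriv01 u differentiable_on {0..1} \<and>
     continuous_on {0..1} (deriv01 (deriv01 u))"

text \<open>\<open>has_caputo_derivative \<alpha> u d t\<close>: for \<open>2 < \<alpha> \<le> 3\<close> and \<open>u\<close> of class \<open>C\<^sup>2\<close>, the Caputo
  derivative of order \<open>\<alpha>\<close> of \<open>u\<close> exists at the point \<open>t\<close> of \<open>(0, 1)\<close> and equals \<open>d\<close>.\<close>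

definition has_caputo_derivative ::
    "real \<Rightarrow> (real \<Rightarrow> real) \<Rightarrow> real \<Rightarrow> real \<Rightarrow> bool" where
  "has_caputo_derivative \<alpha> u d t \<longleftrightarrow>
     (rl_integral (3 - \<alpha>) (\<lambda>s. deriv01 (deriv01 u) s - deriv01 (deriv01 u) 0)
        has_real_derivative d) (at t)"


subsection \<open>The boundary value problem and its constants\<close>

definition green :: "real \<Rightarrow> real \<Rightarrow> real \<Rightarrow> real" where
  "green \<alpha> t s = 1 / Gamma \<alpha> *
     (if s \<le> t then t * (1 - s) powr (\<alpha> - 1) - (t - s) powr (\<alpha> - 1)
      else t * (1 - s) powr (\<alpha> - 1))"

definition g_fun :: "real \<Rightarrow> (real \<Rightarrow> real) \<Rightarrow> real \<Rightarrow> real" where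
  "g_fun \<alpha> A s = rs_integral (\<lambda>t. green \<alpha> t s) A 0 1"

definition gamma_fun :: "(real \<Rightarrow> real) \<Rightarrow> (real \<Rightarrow> real) \<Rightarrow> real" where
  "gamma_fun A u = rs_integral u A 0 1"

definition Lam :: "real \<Rightarrow> real \<Rightarrow> real \<Rightarrow> (real \<Rightarrow> real) \<Rightarrow> real" where
  "Lam \<eta> \<mu> \<beta> A = \<mu> * \<eta> + \<beta> * rs_integral (\<lambda>t. t) A 0 1"

definition Psi :: "real \<Rightarrow> real \<Rightarrow> real" where
  "Psi \<alpha> s = (1 - s) powr (\<alpha> - 1) / Gamma \<alpha>"

definition tau1 :: "real \<Rightarrow> real \<Rightarrow> real \<Rightarrow> real \<Rightarrow> (real \<Rightarrow> real) \<Rightarrow> real" where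
  "tau1 \<alpha> \<eta> \<mu> \<beta> A =
     (\<eta> - \<eta> powr (\<alpha> - 1)) / (1 - Lam \<eta> \<mu> \<beta> A) *
     integral {0..1} (\<lambda>s. (s - s powr (\<alpha> - 1)) *
       (\<beta> * g_fun \<alpha> A s + (\<mu> - Lam \<eta> \<mu> \<beta> A + 1) * Psi \<alpha> s))"

definition tau2 :: "real \<Rightarrow> real \<Rightarrow> real \<Rightarrow> real \<Rightarrow> (real \<Rightarrow> real) \<Rightarrow> real" where
  "tau2 \<alpha> \<eta> \<mu> \<beta> A =
     1 / (1 - Lam \<eta> \<mu> \<beta> A) *
     (\<beta> * integral {0..1} (g_fun \<alpha> A) + (\<mu> - Lam \<eta> \<mu> \<beta> A + 1) / Gamma (\<alpha> + 1))"

definition bvp_solution ::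
    "real \<Rightarrow> real \<Rightarrow> real \<Rightarrow> real \<Rightarrow> (real \<Rightarrow> real) \<Rightarrow> (real \<Rightarrow> real \<Rightarrow> real) \<Rightarrow> (real \<Rightarrow> real) \<Rightarrow> bool"
  where
  "bvp_solution \<alpha> \<eta> \<mu> \<beta> A f u \<longleftrightarrow>
     C2_on01 u \<and>
     (\<forall>t\<in>{0<..<1}. \<exists>d. has_caputo_derivative \<alpha> u d t \<and> d + f t (u t) = 0) \<and>
     u 0 = 0 \<and> deriv01 (deriv01 u) 0 = 0 \<and>
     u 1 = \<mu> * u \<eta> + \<beta> * gamma_fun A u"

definition positive_bvp_solution ::
    "real \<Rightarrow> real \<Rightarrow> real \<Rightarrow> real \<Rightarrow> (real \<Rightarrow> real) \<Rightarrow> (real \<Rightarrow> real \<Rightarrow> real) \<Rightarrow> (real \<Rightarrow> real) \<Rightarrow> bool"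
  where
  "positive_bvp_solution \<alpha> \<eta> \<mu> \<beta> A f u \<longleftrightarrow>
     bvp_solution \<alpha> \<eta> \<mu> \<beta> A f u \<and> (\<forall>t\<in>{0..1}. u t \<ge> 0) \<and> (\<exists>t\<in>{0..1}. u t \<noteq> 0)"

end

theory Submission
  imports Defs "HOL-Complex_Analysis.Great_Picard"
begin

text \<open>
  Write \<open>\<Lambda>\<close> for \<open>Lam \<eta> \<mu> \<beta> A\<close> and \<open>g\<close> for \<open>g_fun \<alpha> A\<close>. Integrating the equation and fitting the boundary
  conditions turns the boundary value problem into the Hammerstein equation
  \<open>u t = (\<integral>s. K t s * f s (u s))\<close> on \<open>[0, 1]\<close> with the kernel
  \<open>K t s = t / (1 - \<Lambda>) * (\<mu> * green \<alpha> \<eta> s + \<beta> * g s) + green \<alpha> t s\<close>.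
  The elementary estimates \<open>(t - t powr (\<alpha> - 1)) * Psi \<alpha> s \<le> green \<alpha> t s \<le> Psi \<alpha> s\<close> give the Harnack-type
  sandwich \<open>c t * \<Phi> s \<le> K t s \<le> \<Phi> s\<close>, where \<open>\<Phi> = (\<beta> * g + (\<mu> - \<Lambda> + 1) * Psi \<alpha>) / (1 - \<Lambda>)\<close> and
  \<open>c t = (\<eta> - \<eta> powr (\<alpha> - 1)) * (t - t powr (\<alpha> - 1))\<close>. The two constants of the theorem are then
  \<open>\<tau>\<^sub>2 = \<integral>\<Phi>\<close> and \<open>\<tau>\<^sub>1 = \<integral>c * \<Phi>\<close>.

  Condition C1, \<open>a * \<tau>\<^sub>2 < 1\<close>, makes the integral operator \<open>T\<close> map the functions with values in \<open>[0, R]\<close>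
  into themselves for large \<open>R\<close>, with room to spare. The zero function may be a fixed point, so the
  operator is perturbed to \<open>T + p\<close> with a small constant \<open>p > 0\<close>. If \<open>u\<close> is nearly a fixed point of
  \<open>T + p\<close> and \<open>u \<le> \<delta>\<close> throughout, then C2 and the lower kernel bound give
  \<open>u t \<ge> p / 2 + c t * b * (\<integral>\<Phi> * u)\<close>; integrating against \<open>\<Phi>\<close> and using \<open>b * \<tau>\<^sub>1 \<ge> 1\<close> yields
  \<open>(\<integral>\<Phi> * u) \<ge> p / 2 * (\<integral>\<Phi>) + (\<integral>\<Phi> * u)\<close>, which is absurd. Hence the near fixed points all exceed
  \<open>\<delta>\<close> somewhere, and letting \<open>p\<close> tend to 0 along an Arzela-Ascoli subsequence produces a fixed point
  that is not zero. This replaces a fixed point index computation in the cone of nonnegative functions;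
  it is \<open>hammerstein_positive_fixed_point\<close>. Only approximate fixed points of \<open>T + p\<close> are needed, and
  these come from the combinatorial lemma behind Brouwer's theorem (\<open>approximate_brouwer_cube\<close>),
  carried over to functions by a partition of unity (\<open>approximate_schauder\<close>).

  Two bodies of theory connect the fixed point with the boundary value problem. For the
  Riemann-Stieltjes integral against a function of bounded variation, the key is a comparison of two
  tagged divisions that depends on the integrand only through its modulus of continuity
  (\<open>rs_sum_diff_le\<close>); it gives existence, continuity of \<open>g\<close>, and the interchange of integrals
  \<open>rs_integral_fubini\<close>. For fractional integrals, the semigroup law \<open>rl_integral_semigroup\<close> shows that
  \<open>rl_integral (1 + \<nu>) y\<close> is an antiderivative of \<open>rl_integral \<nu> y\<close> and that the Caputo derivative
  inverts \<open>rl_integral \<alpha>\<close> (\<open>caputo_problem_solution\<close>).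
\<close>

section \<open>Continuity along sections and moduli of continuity\<close>

lemma continuous_on_along_graph:
  fixes F :: "real \<Rightarrow> real \<Rightarrow> real"
  assumes F: "continuous_on (S \<times> U) (\<lambda>(x, y). F x y)" and "continuous_on W g" "continuous_on W h"
    "\<And>y. y \<in> W \<Longrightarrow> g y \<in> S" "\<And>y. y \<in> W \<Longrightarrow> h y \<in> U"
  shows "continuous_on W (\<lambda>y. F (g y) (h y))"
proof -
  have "continuous_on W ((\<lambda>(x, y). F x y) \<circ> (\<lambda>y. (g y, h y)))"
    by (intro continuous_on_compose continuous_intros assms continuous_on_subset[OF F])
       (use assms(4,5) in auto)
  then show ?thesis by (simp add: o_def)
qed

lemma continuous_on_section:
  fixes F :: "real \<Rightarrow> real \<Rightarrow> real"
  assumes "continuous_on (S \<times> U) (\<lambda>(x, y). F x y)" "x \<in> S"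
  shows "continuous_on U (\<lambda>y. F x y)"
  using assms by (intro continuous_on_along_graph[OF assms(1)] continuous_intros) auto

text \<open>
  Uniform continuity in coordinate form, which avoids the product metric in later estimates.
\<close>

lemma uniform_modulus_on_compact_product:
  fixes F :: "real \<Rightarrow> real \<Rightarrow> real"
  assumes "compact S" "compact U" and F: "continuous_on (S \<times> U) (\<lambda>(x, y). F x y)" and e: "e > 0"
  obtains d where "d > 0" "\<And>x y x' y'. \<lbrakk>x \<in> S; y \<in> U; x' \<in> S; y' \<in> U; \<bar>x - x'\<bar> < d; \<bar>y - y'\<bar> < d\<rbrakk>
    \<Longrightarrow> \<bar>F x y - F x' y'\<bar> < e"
proof -
  have "uniformly_continuous_on (S \<times> U) (\<lambda>(x, y). F x y)"
    by (intro compact_uniformly_continuous compact_Times assms)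
  then obtain d where d: "d > 0" and dF: "\<forall>z\<in>S \<times> U. \<forall>z'\<in>S \<times> U. dist z' z < d \<longrightarrow>
      dist (case z' of (x, y) \<Rightarrow> F x y) (case z of (x, y) \<Rightarrow> F x y) < e"
    unfolding uniformly_continuous_on_def using e by meson
  show ?thesis
  proof (rule that[of "d/2"])
    fix x y x' y' assume *: "x \<in> S" "y \<in> U" "x' \<in> S" "y' \<in> U" "\<bar>x - x'\<bar> < d/2" "\<bar>y - y'\<bar> < d/2"
    have "dist (x, y) (x', y') \<le> \<bar>x - x'\<bar> + \<bar>y - y'\<bar>"
      unfolding dist_Pair_Pair dist_real_def by (rule order_trans[OF sqrt_sum_squares_le_sum_abs]) simp
    then have "dist (x, y) (x', y') < d" using * by linarith
    then have "dist (F x y) (F x' y') < e"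
      using dF[rule_format, of "(x', y')" "(x, y)"] * by simp
    then show "\<bar>F x y - F x' y'\<bar> < e" by (simp add: dist_real_def)
  qed (use d in simp)
qed

section \<open>Approximate fixed points\<close>

text \<open>
  Vectors are functions on the natural numbers of which only the entries below \<open>n\<close> matter, so that
  the dimension may grow with the desired accuracy. Label a grid point in direction \<open>i\<close> by whether \<open>F\<close>
  moves it down or not; Kuhn's lemma provides a small cell on which both labels occur in each
  direction, and continuity forces \<open>F\<close> to move the points of that cell only slightly.
\<close>

lemma approximate_brouwer_cube:
  fixes F :: "(nat \<Rightarrow> real) \<Rightarrow> nat \<Rightarrow> real"
  assumes R: "R > 0" and \<epsilon>: "\<epsilon> > 0"
    and range: "\<And>x i. (\<And>j. j < n \<Longrightarrow> x j \<in> {0..R}) \<Longrightarrow> i < n \<Longrightarrow> F x i \<in> {0..R}"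
    and cont: "\<And>e. e > 0 \<Longrightarrow> \<exists>d>0. \<forall>x y. (\<forall>j<n. x j \<in> {0..R} \<and> y j \<in> {0..R} \<and> \<bar>x j - y j\<bar> \<le> d)
                 \<longrightarrow> (\<forall>i<n. \<bar>F x i - F y i\<bar> \<le> e)"
  obtains x where "\<And>j. j < n \<Longrightarrow> x j \<in> {0..R}" "\<And>i. i < n \<Longrightarrow> \<bar>F x i - x i\<bar> \<le> \<epsilon>"
proof -
  obtain d where d: "d > 0" and dF: "\<And>x y i. (\<And>j. j < n \<Longrightarrow> x j \<in> {0..R} \<and> y j \<in> {0..R} \<and> \<bar>x j - y j\<bar> \<le> d)
                 \<Longrightarrow> i < n \<Longrightarrow> \<bar>F x i - F y i\<bar> \<le> \<epsilon>/2"
    using cont[of "\<epsilon>/2"] \<epsilon> by (metis half_gt_zero)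
  define m where "m = min d (\<epsilon>/2)"
  have m: "m > 0" using d \<epsilon> by (simp add: m_def)
  obtain p :: nat where p: "R / m < real p" using reals_Archimedean2 by blast
  have p0: "p > 0" using p R m by (cases p) (auto simp: divide_less_0_iff)
  have Rp: "R / real p \<le> m" using p p0 m by (simp add: field_simps)
  define pt where "pt = (\<lambda>(x::nat\<Rightarrow>nat) i. R * real (x i) / real p)"
  have pt_in: "pt x j \<in> {0..R}" if "x j \<le> p" for x j
    using that R p0 by (auto simp: pt_def field_simps)
  \<comment> \<open>at the faces of the cube the label is prescribed as Kuhn's lemma demands; \<open>range\<close> makes that consistent\<close>
  define lab where "lab = (\<lambda>(x::nat\<Rightarrow>nat) i.
     if x i = p \<or> (x i \<noteq> 0 \<and> F (pt x) i < pt x i) then 1 else (0::nat))"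
  obtain q where q: "\<forall>i<n. q i < p"
    and rs: "\<forall>i<n. \<exists>r s. (\<forall>j<n. q j \<le> r j \<and> r j \<le> q j + 1) \<and> (\<forall>j<n. q j \<le> s j \<and> s j \<le> q j + 1) \<and> lab r i \<noteq> lab s i"
    by (rule kuhn_lemma[OF p0, of n lab]) (use p0 in \<open>auto simp: lab_def\<close>)
  have low: "F (pt x) i \<ge> pt x i" if "lab x i = 0" "\<And>j. j < n \<Longrightarrow> x j \<le> p" "i < n" for x i
  proof (cases "x i = 0")
    case True
    then show ?thesis using range[of "pt x" i] pt_in that by (auto simp: pt_def)
  next
    case False
    then show ?thesis using that by (auto simp: lab_def split: if_splits)
  qed
  have upp: "F (pt x) i \<le> pt x i" if "lab x i \<noteq> 0" "\<And>j. j < n \<Longrightarrow> x j \<le> p" "i < n" for x i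
  proof (cases "x i = p")
    case True
    then have "pt x i = R" using p0 by (simp add: pt_def)
    then show ?thesis using range[of "pt x" i] pt_in that by auto
  next
    case False
    then show ?thesis using that by (auto simp: lab_def split: if_splits)
  qed
  show ?thesis
  proof
    show in_q: "pt q j \<in> {0..R}" if "j < n" for j using pt_in q that by (simp add: less_imp_le)
    fix i assume i: "i < n"
    have near: "\<bar>pt q j - pt x j\<bar> \<le> m" "pt x j \<in> {0..R}" "x j \<le> p"
      if "\<forall>j<n. q j \<le> x j \<and> x j \<le> q j + 1" "j < n" for x j
    proof -
      have *: "q j \<le> x j" "x j \<le> q j + 1" "q j < p" using that q by auto
      show "x j \<le> p" using * by auto
      then show "pt x j \<in> {0..R}" by (rule pt_in)
      have "\<bar>pt q j - pt x j\<bar> = R / p * (real (x j) - real (q j))"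
        using * R by (simp add: pt_def field_simps abs_if)
      also have "\<dots> \<le> R / p * 1" by (intro mult_left_mono) (use * R in auto)
      finally show "\<bar>pt q j - pt x j\<bar> \<le> m" using Rp by simp
    qed
    obtain r s where r: "\<forall>j<n. q j \<le> r j \<and> r j \<le> q j + 1" and s: "\<forall>j<n. q j \<le> s j \<and> s j \<le> q j + 1"
      and l: "lab r i = 0" "lab s i \<noteq> 0"
    proof -
      obtain r s where *: "\<forall>j<n. q j \<le> r j \<and> r j \<le> q j + 1" "\<forall>j<n. q j \<le> s j \<and> s j \<le> q j + 1" "lab r i \<noteq> lab s i"
        using rs i by blast
      show ?thesis
      proof (cases "lab r i = 0")
        case True then show ?thesis using that[of r s] * by auto
      next
        case False
        then have "lab s i = 0" using *(3) by (auto simp: lab_def split: if_splits)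
        then show ?thesis using that[of s r] * False by auto
      qed
    qed
    have m2: "m \<le> d" "m \<le> \<epsilon>/2" by (auto simp: m_def)
    have "\<bar>F (pt q) i - F (pt r) i\<bar> \<le> \<epsilon>/2"
      using near(1,2)[OF r] in_q m2 i by (intro dF) force+
    moreover have "\<bar>F (pt q) i - F (pt s) i\<bar> \<le> \<epsilon>/2"
      using near(1,2)[OF s] in_q m2 i by (intro dF) force+
    moreover have "F (pt r) i \<ge> pt r i" using low[OF l(1) near(3)[OF r] i] by auto
    moreover have "F (pt s) i \<le> pt s i" using upp[OF l(2) near(3)[OF s] i] by auto
    moreover have "\<bar>pt q i - pt r i\<bar> \<le> m" "\<bar>pt q i - pt s i\<bar> \<le> m" using near(1) r s i by auto
    ultimately show "\<bar>F (pt q) i - pt q i\<bar> \<le> \<epsilon>" using m2 unfolding abs_le_iff by linarith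
  qed
qed

text \<open>
  The order interval between the constants 0 and \<open>R\<close> in the space of continuous functions on
  \<open>[0, 1]\<close>. Functions are total, and their values outside \<open>[0, 1]\<close> are unconstrained.
\<close>

definition order_box :: "real \<Rightarrow> (real \<Rightarrow> real) set" where
  "order_box R = {u. continuous_on {0..1} u \<and> (\<forall>t\<in>{0..1}. u t \<in> {0..R})}"

text \<open>
  A function is replaced by the weighted average of its values at the nodes \<open>i / N\<close>, the weights being
  hat functions supported near their nodes. This makes \<open>T\<close> a map of a finite-dimensional cube, and a near
  fixed point there interpolates to a near fixed point of \<open>T\<close>, because functions in the range of \<open>T\<close>
  vary little on the support of a hat. The weights are normalised by their sum, so only
  positivity of that sum has to be known.
\<close>

lemma approximate_schauder:
  fixes T :: "(real \<Rightarrow> real) \<Rightarrow> real \<Rightarrow> real"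
  assumes R: "R > 0" and \<epsilon>: "\<epsilon> > 0"
    and range: "\<And>u t. u \<in> order_box R \<Longrightarrow> t \<in> {0..1} \<Longrightarrow> T u t \<in> {0..R}"
    and cont: "\<And>e. e > 0 \<Longrightarrow> \<exists>d>0. \<forall>u\<in>order_box R. \<forall>v\<in>order_box R. (\<forall>t\<in>{0..1}. \<bar>u t - v t\<bar> \<le> d)
                 \<longrightarrow> (\<forall>t\<in>{0..1}. \<bar>T u t - T v t\<bar> \<le> e)"
    and equicont: "\<And>e. e > 0 \<Longrightarrow> \<exists>d>0. \<forall>u\<in>order_box R. \<forall>s\<in>{0..1}. \<forall>t\<in>{0..1}. \<bar>s - t\<bar> \<le> d
                 \<longrightarrow> \<bar>T u s - T u t\<bar> \<le> e"
  obtains u where "u \<in> order_box R" "\<And>t. t \<in> {0..1} \<Longrightarrow> \<bar>u t - T u t\<bar> \<le> \<epsilon>"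
proof -
  obtain d where d: "d > 0" and dT: "\<And>u s t. \<lbrakk>u \<in> order_box R; s \<in> {0..1}; t \<in> {0..1}; \<bar>s - t\<bar> \<le> d\<rbrakk>
                 \<Longrightarrow> \<bar>T u s - T u t\<bar> \<le> \<epsilon>/2"
    using equicont[of "\<epsilon>/2"] \<epsilon> by (metis half_gt_zero)
  obtain N :: nat where N: "1 / d < real N" using reals_Archimedean2 by blast
  have N0: "N > 0" using N d by (cases N) (auto simp: divide_less_0_iff)
  have Nd: "1 / real N \<le> d" using N N0 d by (simp add: field_simps)
  define w where "w = (\<lambda>i t. max 0 (1 - \<bar>real N * t - real i\<bar>))"
  define W where "W = (\<lambda>t. \<Sum>i\<le>N. w i t)"
  define P where "P = (\<lambda>x t. (\<Sum>i\<le>N. w i t * x i) / W t)"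
  have w0: "w i t \<ge> 0" for i t by (simp add: w_def)
  have W0: "W t > 0" if "t \<in> {0..1}" for t
  proof -
    define i where "i = nat \<lfloor>real N * t\<rfloor>"
    have Nt: "0 \<le> real N * t" "real N * t \<le> real N" using that by (auto simp: mult_left_le)
    have "real i = of_int \<lfloor>real N * t\<rfloor>" using Nt by (simp add: i_def)
    then have i: "real i \<le> real N * t" "real N * t < real i + 1"
      using floor_correct[of "real N * t"] by auto
    then have "i \<le> N" using Nt by linarith
    have "0 < w i t" using i by (simp add: w_def)
    also have "w i t \<le> W t" unfolding W_def using \<open>i \<le> N\<close> w0 by (intro member_le_sum) auto
    finally show ?thesis .
  qed
  \<comment> \<open>weighted averages obey whatever bound holds at the nodes carrying weight\<close>
  have avg: "\<bar>P x t - c\<bar> \<le> e" if "t \<in> {0..1}" "\<And>i. i \<le> N \<Longrightarrow> w i t > 0 \<Longrightarrow> \<bar>x i - c\<bar> \<le> e" for x t c e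
  proof -
    have "\<bar>(\<Sum>i\<le>N. w i t * x i) - W t * c\<bar> = \<bar>\<Sum>i\<le>N. w i t * (x i - c)\<bar>"
      by (simp add: W_def algebra_simps sum_subtractf sum_distrib_left)
    also have "\<dots> \<le> (\<Sum>i\<le>N. w i t * e)"
    proof (intro order_trans[OF sum_abs] sum_mono)
      fix i assume "i \<in> {..N}"
      then show "\<bar>w i t * (x i - c)\<bar> \<le> w i t * e"
        using that(2)[of i] w0[of i t] by (cases "w i t = 0") (auto simp: abs_mult intro!: mult_left_mono)
    qed
    also have "\<dots> = W t * e" by (simp add: W_def sum_distrib_right)
    finally have "\<bar>(\<Sum>i\<le>N. w i t * x i) - W t * c\<bar> / W t \<le> e"
      using W0[OF that(1)] by (simp add: field_simps)
    moreover have "P x t - c = ((\<Sum>i\<le>N. w i t * x i) - W t * c) / W t"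
      using W0[OF that(1)] by (simp add: P_def field_simps)
    ultimately show ?thesis using W0[OF that(1)] by (simp add: abs_divide)
  qed
  have Pbox: "P x \<in> order_box R" if "\<And>i. i < Suc N \<Longrightarrow> x i \<in> {0..R}" for x
  proof -
    have "continuous_on {0..1} (P x)" unfolding P_def W_def w_def
      by (intro continuous_intros) (use W0 in \<open>force simp: W_def w_def\<close>)
    moreover have "P x t \<in> {0..R}" if t: "t \<in> {0..1}" for t
    proof -
      have "\<bar>P x t - R/2\<bar> \<le> R/2"
      proof (rule avg[OF t])
        fix i assume "i \<le> N"
        then show "\<bar>x i - R/2\<bar> \<le> R/2" using \<open>\<And>i. i < Suc N \<Longrightarrow> x i \<in> {0..R}\<close>[of i] by (auto simp: abs_if)
      qed
      then show ?thesis unfolding abs_le_iff by auto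
    qed
    ultimately show ?thesis by (auto simp: order_box_def)
  qed
  have node: "real i / real N \<in> {0..1}" if "i < Suc N" for i using that N0 by (auto simp: field_simps)
  obtain x where x: "\<And>i. i < Suc N \<Longrightarrow> x i \<in> {0..R}"
    and fx: "\<And>i. i < Suc N \<Longrightarrow> \<bar>T (P x) (real i / real N) - x i\<bar> \<le> \<epsilon>/2"
  proof (rule approximate_brouwer_cube[OF R, of "\<epsilon>/2" "Suc N" "\<lambda>x i. T (P x) (real i / real N)"])
    show "\<epsilon>/2 > 0" using \<epsilon> by simp
    show "T (P x) (real i / real N) \<in> {0..R}" if "\<And>j. j < Suc N \<Longrightarrow> x j \<in> {0..R}" "i < Suc N" for x i
      by (rule range[OF Pbox[OF that(1)] node[OF that(2)]])
    fix e :: real assume "e > 0"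
    then obtain d where d: "d > 0" and dT: "\<And>u v t. \<lbrakk>u\<in>order_box R; v\<in>order_box R; \<And>t. t\<in>{0..1} \<Longrightarrow> \<bar>u t - v t\<bar> \<le> d\<rbrakk>
                 \<Longrightarrow> t\<in>{0..1} \<Longrightarrow> \<bar>T u t - T v t\<bar> \<le> e"
      using cont[of e] by blast
    show "\<exists>d>0. \<forall>x y. (\<forall>j<Suc N. x j \<in> {0..R} \<and> y j \<in> {0..R} \<and> \<bar>x j - y j\<bar> \<le> d)
                 \<longrightarrow> (\<forall>i<Suc N. \<bar>T (P x) (real i / real N) - T (P y) (real i / real N)\<bar> \<le> e)"
    proof (intro exI[of _ d] conjI allI impI d)
      fix x y i assume xy: "\<forall>j<Suc N. x j \<in> {0..R} \<and> y j \<in> {0..R} \<and> \<bar>x j - y j\<bar> \<le> d" and i: "i < Suc N"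
      show "\<bar>T (P x) (real i / real N) - T (P y) (real i / real N)\<bar> \<le> e"
      proof (rule dT[OF Pbox Pbox _ node[OF i]])
        fix t :: real assume t: "t \<in> {0..1}"
        have "\<bar>P (\<lambda>i. x i - y i) t - 0\<bar> \<le> d" using xy by (intro avg[OF t]) auto
        then show "\<bar>P x t - P y t\<bar> \<le> d"
          by (simp add: P_def algebra_simps sum_subtractf diff_divide_distrib)
      qed (use xy in auto)
    qed
  qed (rule that; assumption)
  show ?thesis
  proof
    show "P x \<in> order_box R" by (rule Pbox[OF x])
    fix t :: real assume t: "t \<in> {0..1}"
    show "\<bar>P x t - T (P x) t\<bar> \<le> \<epsilon>"
    proof (rule avg[OF t])
      fix i assume i: "i \<le> N" "w i t > 0"
      then have "\<bar>real N * t - real i\<bar> < 1" by (simp add: w_def)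
      moreover have "\<bar>real i / real N - t\<bar> = \<bar>real N * t - real i\<bar> / real N"
        using N0 by (auto simp: field_simps abs_if)
      ultimately have "\<bar>real i / real N - t\<bar> \<le> 1 / real N" by (simp add: divide_right_mono)
      then have "\<bar>T (P x) (real i / real N) - T (P x) t\<bar> \<le> \<epsilon>/2"
        using Nd i by (intro dT[OF Pbox[OF x] node t]) auto
      then show "\<bar>x i - T (P x) t\<bar> \<le> \<epsilon>" using fx[of i] i by (simp add: abs_if split: if_splits)
    qed
  qed
qed

section \<open>Positive solutions of Hammerstein equations\<close>

lemma integral_prod_bound:
  fixes k g h :: "real \<Rightarrow> real"
  assumes "continuous_on {0..1} k" "continuous_on {0..1} g"
    and "\<And>s. s \<in> {0..1} \<Longrightarrow> \<bar>k s\<bar> \<le> h s" "\<And>s. s \<in> {0..1} \<Longrightarrow> \<bar>g s\<bar> \<le> e" "h integrable_on {0..1}"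
  shows "\<bar>integral {0..1} (\<lambda>s. k s * g s)\<bar> \<le> integral {0..1} h * e"
proof -
  have "\<bar>integral {0..1} (\<lambda>s. k s * g s)\<bar> \<le> integral {0..1} (\<lambda>s. h s * e)"
    unfolding real_norm_def[symmetric]
  proof (rule integral_norm_bound_integral)
    show "(\<lambda>s. k s * g s) integrable_on {0..1}"
      by (intro integrable_continuous_real continuous_intros assms)
    show "(\<lambda>s. h s * e) integrable_on {0..1}" using assms(5) by (rule integrable_on_mult_left)
    fix s :: real assume "s \<in> {0..1}"
    then show "norm (k s * g s) \<le> h s * e"
      unfolding real_norm_def abs_mult using assms(3,4)[of s] by (intro mult_mono) auto
  qed
  then show ?thesis by simp
qed

text \<open>
  The hypothesis on \<open>a\<close> bounds solutions from above, the one on \<open>b\<close> keeps them away from zero: testing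
  the equation with \<open>\<Phi>\<close> shows that a function staying below \<open>\<delta>\<close> cannot nearly solve the equation with an
  added positive constant. The borderline case \<open>b * (\<integral>c * \<Phi>) = 1\<close> is covered thanks to that constant.
\<close>

theorem hammerstein_positive_fixed_point:
  fixes K f :: "real \<Rightarrow> real \<Rightarrow> real" and \<Phi> c :: "real \<Rightarrow> real"
  assumes K: "continuous_on ({0..1} \<times> {0..1}) (\<lambda>(t, s). K t s)"
    and \<Phi>: "continuous_on {0..1} \<Phi>" and c: "continuous_on {0..1} c"
    and c0: "\<And>t. t \<in> {0..1} \<Longrightarrow> 0 \<le> c t"
    and K_up: "\<And>t s. t \<in> {0..1} \<Longrightarrow> s \<in> {0..1} \<Longrightarrow> K t s \<le> \<Phi> s"
    and K_lo: "\<And>t s. t \<in> {0..1} \<Longrightarrow> s \<in> {0..1} \<Longrightarrow> c t * \<Phi> s \<le> K t s"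
    and \<Phi>0: "\<And>s. s \<in> {0..1} \<Longrightarrow> 0 \<le> \<Phi> s"
    and f: "continuous_on ({0..1} \<times> {0..}) (\<lambda>(t, x). f t x)"
    and f0: "\<And>t x. t \<in> {0..1} \<Longrightarrow> x \<ge> 0 \<Longrightarrow> 0 \<le> f t x"
    and f_up: "\<And>t x. t \<in> {0..1} \<Longrightarrow> x \<ge> 0 \<Longrightarrow> f t x \<le> a * x + m"
    and a: "0 \<le> a" "a * integral {0..1} \<Phi> < 1" and m: "0 \<le> m"
    and f_lo: "\<And>t x. t \<in> {0..1} \<Longrightarrow> x \<in> {0..\<delta>} \<Longrightarrow> b * x \<le> f t x"
    and \<delta>: "\<delta> > 0" and b: "b * integral {0..1} (\<lambda>t. c t * \<Phi> t) \<ge> 1" "b \<ge> 0"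
  obtains u where "continuous_on {0..1} u" "\<And>t. t \<in> {0..1} \<Longrightarrow> 0 \<le> u t"
    "\<exists>t\<in>{0..1}. u t \<noteq> 0"
    "\<And>t. t \<in> {0..1} \<Longrightarrow> u t = integral {0..1} (\<lambda>s. K t s * f s (u s))"
proof -
  define P where "P = integral {0..1} \<Phi>"
  have \<Phi>_int: "\<Phi> integrable_on {0..1}" using \<Phi> by (rule integrable_continuous_real)
  have c\<Phi>: "continuous_on {0..1} (\<lambda>t. c t * \<Phi> t)" by (intro continuous_intros \<Phi> c)
  have P0: "P > 0"
  proof (rule ccontr)
    assume "\<not> P > 0"
    have "integral {0..1} (\<lambda>t. c t * \<Phi> t) \<le> P"
      unfolding P_def using K_up K_lo
      by (intro integral_le integrable_continuous_real \<Phi> c\<Phi>) (meson order_trans)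
    then have "b * integral {0..1} (\<lambda>t. c t * \<Phi> t) \<le> 0"
      using b(2) \<open>\<not> P > 0\<close> by (simp add: mult_nonneg_nonpos)
    then show False using b(1) by simp
  qed
  have K0: "0 \<le> K t s" if "t \<in> {0..1}" "s \<in> {0..1}" for t s
    using K_lo[OF that] c0[OF that(1)] \<Phi>0[OF that(2)] by (meson mult_nonneg_nonneg order_trans)
  have K_abs: "\<bar>K t s\<bar> \<le> \<Phi> s" if "t \<in> {0..1}" "s \<in> {0..1}" for t s
    using K0[OF that] K_up[OF that] by simp
  have K_s: "continuous_on {0..1} (\<lambda>s. K t s)" if "t \<in> {0..1}" for t
    using continuous_on_section[OF K that] .
  \<comment> \<open>the solution of \<open>(a * R + m) * P + 1 = R\<close>: the summand 1 is the room for the perturbation\<close>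
  define R where "R = (m * P + 1) / (1 - a * P)"
  have aP: "1 - a * P > 0" using a by (simp add: P_def)
  have mP: "m * P \<ge> 0" using m P0 by simp
  have R0: "R > 0" unfolding R_def using aP mP by (intro divide_pos_pos) auto
  have R_eq: "(a * R + m) * P + 1 = R" using aP by (simp add: R_def field_simps)
  define M where "M = a * R + m"
  have M0: "M \<ge> 0" using a m R0 by (simp add: M_def)
  have comp: "continuous_on {0..1} (\<lambda>s. f s (u s))" if "u \<in> order_box R" for u
    using that by (intro continuous_on_along_graph[OF f] continuous_intros) (auto simp: order_box_def)
  have f_M: "0 \<le> f s (u s)" "f s (u s) \<le> M" if "u \<in> order_box R" "s \<in> {0..1}" for u s
  proof -
    have us: "0 \<le> u s" "u s \<le> R" using that by (auto simp: order_box_def)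
    show "0 \<le> f s (u s)" using f0 us that by simp
    have "a * u s \<le> a * R" using us a by (intro mult_left_mono) auto
    then show "f s (u s) \<le> M" using f_up[OF that(2) us(1)] by (simp add: M_def)
  qed
  define T where "T = (\<lambda>u t. integral {0..1} (\<lambda>s. K t s * f s (u s)))"
  have Kf_int: "(\<lambda>s. K t s * f s (u s)) integrable_on {0..1}" if "u \<in> order_box R" "t \<in> {0..1}" for u t
    by (intro integrable_continuous_real continuous_intros K_s comp that)
  have T0: "0 \<le> T u t" if "u \<in> order_box R" "t \<in> {0..1}" for u t
    unfolding T_def by (intro integral_nonneg Kf_int that mult_nonneg_nonneg K0 f_M(1))
  have T_le: "T u t \<le> P * M" if "u \<in> order_box R" "t \<in> {0..1}" for u t
  proof -
    have "\<bar>T u t\<bar> \<le> P * M" unfolding T_def P_def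
      by (intro integral_prod_bound K_s comp K_abs \<Phi>_int that) (use f_M that in auto)
    then show ?thesis by simp
  qed
  have T_equi: "\<exists>d>0. \<forall>u\<in>order_box R. \<forall>s\<in>{0..1}. \<forall>t\<in>{0..1}. \<bar>s - t\<bar> \<le> d \<longrightarrow> \<bar>T u s - T u t\<bar> \<le> e"
    if "e > 0" for e
  proof -
    have "e / (M + 1) > 0" using \<open>e > 0\<close> M0 by simp
    from uniform_modulus_on_compact_product[OF compact_Icc compact_Icc K this]
    obtain d where d: "d > 0" and dK: "\<And>t s t' s'. \<lbrakk>t \<in> {0..1}; s \<in> {0..1}; t' \<in> {0..1}; s' \<in> {0..1};
        \<bar>t - t'\<bar> < d; \<bar>s - s'\<bar> < d\<rbrakk> \<Longrightarrow> \<bar>K t s - K t' s'\<bar> < e / (M + 1)"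
      by blast
    show ?thesis
    proof (intro exI[of _ "d/2"] conjI ballI impI)
      fix u and s t :: real
      assume u: "u \<in> order_box R" and st: "s \<in> {0..1}" "t \<in> {0..1}" "\<bar>s - t\<bar> \<le> d/2"
      have "T u s - T u t = integral {0..1} (\<lambda>r. (K s r - K t r) * f r (u r))"
        unfolding T_def by (subst integral_diff[symmetric]) (auto intro!: Kf_int u st simp: algebra_simps)
      also have "\<bar>\<dots>\<bar> \<le> integral {0..1} (\<lambda>r::real. e / (M + 1)) * M"
      proof (intro integral_prod_bound continuous_intros K_s comp u st)
        fix r :: real assume r: "r \<in> {0..1}"
        show "\<bar>K s r - K t r\<bar> \<le> e / (M + 1)"
          using dK[OF st(1) r st(2) r] st d by simp
        show "\<bar>f r (u r)\<bar> \<le> M" using f_M[OF u r] by simp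
      qed auto
      also have "\<dots> \<le> e" using \<open>e > 0\<close> M0 by (simp add: field_simps)
      finally show "\<bar>T u s - T u t\<bar> \<le> e" .
    qed (use d in simp)
  qed
  have T_cont: "\<exists>d>0. \<forall>u\<in>order_box R. \<forall>v\<in>order_box R. (\<forall>t\<in>{0..1}. \<bar>u t - v t\<bar> \<le> d)
                 \<longrightarrow> (\<forall>t\<in>{0..1}. \<bar>T u t - T v t\<bar> \<le> e)" if "e > 0" for e
  proof -
    have "e / P > 0" using \<open>e > 0\<close> P0 by simp
    moreover have "continuous_on ({0..1} \<times> {0..R}) (\<lambda>(t, x). f t x)" by (rule continuous_on_subset[OF f]) auto
    ultimately obtain d where d: "d > 0" and df: "\<And>t s t' s'. \<lbrakk>t \<in> {0..1}; s \<in> {0..R}; t' \<in> {0..1}; s' \<in> {0..R};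
        \<bar>t - t'\<bar> < d; \<bar>s - s'\<bar> < d\<rbrakk> \<Longrightarrow> \<bar>f t s - f t' s'\<bar> < e / P"
      using uniform_modulus_on_compact_product[OF compact_Icc compact_Icc] by metis
    show ?thesis
    proof (intro exI[of _ "d/2"] conjI ballI impI)
      fix u v and t :: real
      assume uv: "u \<in> order_box R" "v \<in> order_box R" and t: "t \<in> {0..1}"
        and le: "\<forall>t\<in>{0..1}. \<bar>u t - v t\<bar> \<le> d/2"
      have "T u t - T v t = integral {0..1} (\<lambda>r. K t r * (f r (u r) - f r (v r)))"
        unfolding T_def by (subst integral_diff[symmetric]) (auto intro!: Kf_int uv t simp: algebra_simps)
      also have "\<bar>\<dots>\<bar> \<le> P * (e / P)"
        unfolding P_def
      proof (intro integral_prod_bound continuous_intros K_s comp uv t K_abs \<Phi>_int)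
        fix r :: real assume r: "r \<in> {0..1}"
        have "\<bar>u r - v r\<bar> < d" using bspec[OF le r] d by simp
        moreover have "u r \<in> {0..R}" "v r \<in> {0..R}" using uv r by (auto simp: order_box_def)
        ultimately show "\<bar>f r (u r) - f r (v r)\<bar> \<le> e / integral {0..1} \<Phi>"
          using df[OF r _ r, of "u r" "v r"] d by (simp add: P_def)
      qed auto
      also have "\<dots> \<le> e" using P0 by simp
      finally show "\<bar>T u t - T v t\<bar> \<le> e" .
    qed (use d in simp)
  qed

  have approx: "\<exists>u\<in>order_box R. (\<forall>t\<in>{0..1}. \<bar>u t - T u t - p\<bar> \<le> p/2)" if p: "0 < p" "p \<le> 1" for p
  proof -
    obtain u where u: "u \<in> order_box R" "\<And>t. t \<in> {0..1} \<Longrightarrow> \<bar>u t - (T u t + p)\<bar> \<le> p/2"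
    proof (rule approximate_schauder[OF R0, of "p/2" "\<lambda>u t. T u t + p"])
      fix u and t :: real assume u: "u \<in> order_box R" and t: "t \<in> {0..1}"
      have "T u t + p \<le> P * M + 1" using T_le[OF u t] p by simp
      also have "\<dots> = R" using R_eq by (simp add: M_def algebra_simps)
      finally show "T u t + p \<in> {0..R}" using T0[OF u t] p by simp
    qed (use p T_equi T_cont in \<open>auto intro: that\<close>)
    then show ?thesis by (intro bexI[of _ u]) (simp_all add: diff_diff_eq)
  qed

  have away: "\<exists>t\<in>{0..1}. u t > \<delta>"
    if p: "0 < p" and u: "u \<in> order_box R" and up: "\<And>t. t \<in> {0..1} \<Longrightarrow> \<bar>u t - T u t - p\<bar> \<le> p/2" for p u
  proof (rule ccontr)
    assume "\<not> (\<exists>t\<in>{0..1}. u t > \<delta>)"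
    then have small: "u t \<in> {0..\<delta>}" if "t \<in> {0..1}" for t using u that by (force simp: order_box_def)
    have u_cont: "continuous_on {0..1} u" using u by (simp add: order_box_def)
    \<comment> \<open>integrating the pointwise bound below against \<open>\<Phi>\<close> bounds \<open>L\<close> from below by \<open>L\<close> plus a positive number\<close>
    define L where "L = integral {0..1} (\<lambda>t. \<Phi> t * u t)"
    have L0: "L \<ge> 0" unfolding L_def
      by (intro integral_nonneg integrable_continuous_real continuous_intros \<Phi> u_cont mult_nonneg_nonneg \<Phi>0)
         (use small in auto)
    have pt: "u t \<ge> p/2 + c t * (b * L)" if t: "t \<in> {0..1}" for t
    proof -
      have "c t * (b * L) = integral {0..1} (\<lambda>s. c t * \<Phi> s * (b * u s))"
        by (simp add: L_def mult_ac flip: integral_mult_right)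
      also have "\<dots> \<le> T u t" unfolding T_def
      proof (rule integral_le)
        show "(\<lambda>s. c t * \<Phi> s * (b * u s)) integrable_on {0..1}"
          by (intro integrable_continuous_real continuous_intros \<Phi> u_cont)
        show "(\<lambda>s. K t s * f s (u s)) integrable_on {0..1}" by (rule Kf_int[OF u t])
        fix s :: real assume s: "s \<in> {0..1}"
        show "c t * \<Phi> s * (b * u s) \<le> K t s * f s (u s)"
          using small[OF s] by (intro mult_mono K_lo f_lo s t K0) (use b in auto)
      qed
      finally show ?thesis using up[OF t] by (simp add: abs_if split: if_splits)
    qed
    have "p/2 * P + integral {0..1} (\<lambda>t. c t * \<Phi> t) * (b * L)
        = integral {0..1} (\<lambda>t. p/2 * \<Phi> t) + integral {0..1} (\<lambda>t. c t * \<Phi> t * (b * L))"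
      by (simp add: P_def)
    also have "\<dots> = integral {0..1} (\<lambda>t. p/2 * \<Phi> t + c t * \<Phi> t * (b * L))"
      by (intro integral_add[symmetric] integrable_continuous_real continuous_intros \<Phi> c)
    also have "\<dots> \<le> L" unfolding L_def
    proof (intro integral_le integrable_continuous_real continuous_intros \<Phi> c u_cont)
      fix t :: real assume t: "t \<in> {0..1}"
      have "\<Phi> t * (p/2 + c t * (b * L)) \<le> \<Phi> t * u t"
        by (intro mult_left_mono pt \<Phi>0 t)
      then show "p/2 * \<Phi> t + c t * \<Phi> t * (b * integral {0..1} (\<lambda>t. \<Phi> t * u t)) \<le> \<Phi> t * u t"
        by (simp add: algebra_simps L_def)
    qed
    finally have "p/2 * P + (b * integral {0..1} (\<lambda>t. c t * \<Phi> t)) * L \<le> L"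
      by (simp add: mult_ac)
    moreover have "1 * L \<le> (b * integral {0..1} (\<lambda>t. c t * \<Phi> t)) * L"
      by (rule mult_right_mono[OF b(1) L0])
    moreover have "p/2 * P > 0" using p P0 by simp
    ultimately show False by linarith
  qed

  \<comment> \<open>an error of \<open>p n / 2\<close> still leaves a positive part of the perturbation\<close>
  define p where "p = (\<lambda>n::nat. 1 / (real n + 1))"
  have p: "0 < p n" "p n \<le> 1" for n by (auto simp: p_def)
  have "\<forall>n. \<exists>u. u \<in> order_box R \<and> (\<forall>t\<in>{0..1}. \<bar>u t - T u t - p n\<bar> \<le> p n/2)"
    using approx p by blast
  then obtain v where v: "\<And>n. v n \<in> order_box R"
    and vT: "\<And>n t. t \<in> {0..1} \<Longrightarrow> \<bar>v n t - T (v n) t - p n\<bar> \<le> p n/2"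
    by metis
  obtain g k where g: "continuous_on {0..1} g" and k: "strict_mono (k :: nat \<Rightarrow> nat)"
    and lim: "\<And>e. 0 < e \<Longrightarrow> \<exists>N. \<forall>n x. n \<ge> N \<and> x \<in> {0..1} \<longrightarrow> norm (T (v (k n)) x - g x) < e"
  proof (rule Arzela_Ascoli[of "{0..1::real}" "\<lambda>n t. T (v n) t" "P * M"])
    show "norm (T (v n) x) \<le> P * M" if "x \<in> {0..1}" for n x
      using T0[OF v that] T_le[OF v that] by simp
    fix x e :: real assume x: "x \<in> {0..1}" and e: "0 < e"
    obtain d where "d > 0" and d: "\<And>u s t. u \<in> order_box R \<Longrightarrow> s \<in> {0..1} \<Longrightarrow> t \<in> {0..1} \<Longrightarrow>
        \<bar>s - t\<bar> \<le> d \<Longrightarrow> \<bar>T u s - T u t\<bar> \<le> e/2"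
      using T_equi[of "e/2"] e by (metis half_gt_zero)
    show "\<exists>d>0. \<forall>n y. y \<in> {0..1} \<and> norm (x - y) < d \<longrightarrow> norm (T (v n) x - T (v n) y) < e"
    proof (intro exI[of _ d] conjI allI impI)
      fix n y assume y: "y \<in> {0..1} \<and> norm (x - y) < d"
      then have "\<bar>T (v n) x - T (v n) y\<bar> \<le> e/2" by (intro d[OF v x]) auto
      then show "norm (T (v n) x - T (v n) y) < e" using e by simp
    qed (use \<open>d > 0\<close> in simp)
  qed (auto intro: that)
  have conv: "\<exists>N. \<forall>n\<ge>N. \<forall>t\<in>{0..1}. \<bar>v (k n) t - g t\<bar> < e" if e: "e > 0" for e
  proof -
    obtain N1 where N1: "\<And>n x. n \<ge> N1 \<Longrightarrow> x \<in> {0..1} \<Longrightarrow> norm (T (v (k n)) x - g x) < e/2"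
      using lim[of "e/2"] e by auto
    obtain N2 :: nat where N2: "4 / e < real N2" using reals_Archimedean2 by blast
    have "\<bar>v (k n) t - g t\<bar> < e" if n: "n \<ge> max N1 N2" and t: "t \<in> {0..1}" for n t
    proof -
      have "real N2 \<le> real (k n)" using n seq_suble[OF k, of n] by simp
      then have "4 / e < real (k n) + 1" using N2 by linarith
      then have "p (k n) < e/4" using e by (simp add: p_def field_simps)
      then show ?thesis using N1[of n t] vT[OF t, of "k n"] n t by (simp add: abs_if split: if_splits)
    qed
    then show ?thesis by blast
  qed
  have g_in: "g t \<in> {0..R}" if t: "t \<in> {0..1}" for t
  proof -
    have "-e \<le> g t \<and> g t \<le> R + e" if e: "e > 0" for e
    proof -
      obtain n where "\<bar>v (k n) t - g t\<bar> < e" using conv[OF e] t by blast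
      moreover have "v (k n) t \<in> {0..R}" using v t by (simp add: order_box_def)
      ultimately show ?thesis by (auto simp: abs_if split: if_splits)
    qed
    then have "-g t \<le> 0 + e" "g t \<le> R + e" if "e > 0" for e using that by force+
    then show ?thesis using field_le_epsilon[of "-g t" 0] field_le_epsilon[of "g t" R] by auto
  qed
  have g_box: "g \<in> order_box R" using g g_in by (simp add: order_box_def)
  have fixed: "g t = T g t" if t: "t \<in> {0..1}" for t
  proof -
    have "\<bar>g t - T g t\<bar> \<le> 0 + e" if e: "e > 0" for e
    proof -
      obtain d where "d > 0" and d: "\<And>u v t. \<lbrakk>u \<in> order_box R; v \<in> order_box R;
          \<And>t. t \<in> {0..1} \<Longrightarrow> \<bar>u t - v t\<bar> \<le> d; t \<in> {0..1}\<rbrakk> \<Longrightarrow> \<bar>T u t - T v t\<bar> \<le> e/2"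
        using T_cont[of "e/2"] e by (metis half_gt_zero)
      obtain N1 where N1: "\<And>n t. n \<ge> N1 \<Longrightarrow> t \<in> {0..1} \<Longrightarrow> \<bar>v (k n) t - g t\<bar> < d"
        using conv[OF \<open>d > 0\<close>] by blast
      obtain N2 where N2: "\<And>n t. n \<ge> N2 \<Longrightarrow> t \<in> {0..1} \<Longrightarrow> norm (T (v (k n)) t - g t) < e/2"
        using lim[of "e/2"] e by auto
      define n where "n = max N1 N2"
      have "\<bar>T (v (k n)) t - T g t\<bar> \<le> e/2"
        by (rule d[OF v g_box _ t]) (use N1[of n] in \<open>force simp: n_def\<close>)
      moreover have "\<bar>T (v (k n)) t - g t\<bar> < e/2" using N2[of n t] t by (simp add: n_def)
      ultimately show ?thesis by (simp add: abs_if split: if_splits)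
    qed
    then have "\<bar>g t - T g t\<bar> \<le> 0" by (rule field_le_epsilon)
    then show ?thesis by simp
  qed
  show ?thesis
  proof (rule that[OF g])
    show "0 \<le> g t" if "t \<in> {0..1}" for t using g_in[OF that] by simp
    show "g t = integral {0..1} (\<lambda>s. K t s * f s (g s))" if "t \<in> {0..1}" for t
      using fixed[OF that] by (simp add: T_def)
    obtain N where N: "\<And>t. t \<in> {0..1} \<Longrightarrow> \<bar>v (k N) t - g t\<bar> < \<delta>" using conv[OF \<delta>] by blast
    obtain t where "t \<in> {0..1}" "v (k N) t > \<delta>" using away[OF p(1) v vT] by blast
    then show "\<exists>t\<in>{0..1}. g t \<noteq> 0" using N[of t] by (intro bexI[of _ t]) auto
  qed
qed

section \<open>Riemann-Stieltjes integrals against functions of bounded variation\<close>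

text \<open>
  The empty set needs its own case because it occurs among the intersections of cells, and suprema and
  infima of the empty set are unspecified.
\<close>

definition increment :: "(real \<Rightarrow> real) \<Rightarrow> real set \<Rightarrow> real" where
  "increment A K = (if K = {} then 0 else A (Sup K) - A (Inf K))"

lemma increment_interval: "increment A {a..b} = (if a \<le> b then A b - A a else 0)"
  by (simp add: increment_def)

abbreviation rs_sum :: "(real \<Rightarrow> real) \<Rightarrow> (real \<Rightarrow> real) \<Rightarrow> (real \<times> real set) set \<Rightarrow> real" where
  "rs_sum h A p \<equiv> \<Sum>(x, K)\<in>p. h x * (A (Sup K) - A (Inf K))"

text \<open>
  The increment of \<open>A\<close> over the traces of a fixed interval is an additive interval function, and such
  functions can be summed over the cells of a division.
\<close>

lemma increment_split:
  assumes p: "p tagged_division_of {a..b}" and "{u..v} \<subseteq> {a..b}" "a \<le> b"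
  shows "(\<Sum>(y, L)\<in>p. increment A ({u..v} \<inter> L)) = increment A {u..v}"
proof -
  interpret operative_real plus 0 "\<lambda>L. increment A ({u..v} \<inter> L)"
    rewrites "comm_monoid_set.F (+) 0 = sum"
  proof -
    show "operative_real plus 0 (\<lambda>L. increment A ({u..v} \<inter> L))"
      by standard (auto simp: increment_interval max_def min_def intro!: arg_cong[of _ _ A])
  qed (auto simp add: sum_def)
  have "(\<Sum>(y, L)\<in>p. increment A ({u..v} \<inter> L)) = increment A ({u..v} \<inter> {a..b})"
    using tagged_division[of p a b] p by simp
  also have "{u..v} \<inter> {a..b} = {u..v}" using assms by blast
  finally show ?thesis .
qed

lemma tagged_cell_interval:
  assumes "p tagged_division_of {a..b::real}" "(x, K) \<in> p"
  obtains u v where "K = {u..v}" "u \<le> x" "x \<le> v" "a \<le> u" "v \<le> b"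
proof -
  obtain u v where "K = cbox u v" using tagged_division_ofD(4)[OF assms] by blast
  moreover have "x \<in> K" "K \<subseteq> {a..b}" using tagged_division_ofD(2,3)[OF assms] by auto
  ultimately show ?thesis using that[of u v] by auto
qed

text \<open>
  The intersections of cells form a common refinement. Distinct pairs of cells may have the
  same intersection, but only when it is degenerate; such intersections carry no increment of \<open>A\<close>, and
  on the remaining pairs the intersection map is injective.
\<close>

lemma sum_increment_refinement_le:
  assumes p: "p tagged_division_of {a..b}" and q: "q tagged_division_of {a..b}"
    and B: "\<And>D. D division_of {a..b} \<Longrightarrow> (\<Sum>K\<in>D. \<bar>A (Sup K) - A (Inf K)\<bar>) \<le> B"
  shows "(\<Sum>(x, K)\<in>p. \<Sum>(y, L)\<in>q. \<bar>increment A (K \<inter> L)\<bar>) \<le> B"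
proof -
  define D where "D = {K \<inter> L |K L. K \<in> snd ` p \<and> L \<in> snd ` q \<and> K \<inter> L \<noteq> {}}"
  have D: "D division_of {a..b}"
    using division_inter[OF division_of_tagged_division[OF p] division_of_tagged_division[OF q]]
    by (simp add: D_def)
  have fin: "finite p" "finite q" using p q by auto
  define c where "c = (\<lambda>z :: (real \<times> real set) \<times> (real \<times> real set). snd (fst z) \<inter> snd (snd z))"
  define Z where "Z = {z \<in> p \<times> q. increment A (c z) \<noteq> 0}"
  have c_int: "\<exists>u v. c z = {u..v} \<and> u < v" if "z \<in> Z" for z
  proof -
    obtain x K y L where z: "z = ((x, K), (y, L))" by (metis surj_pair)
    have xK: "(x, K) \<in> p" and yL: "(y, L) \<in> q" and nz: "increment A (K \<inter> L) \<noteq> 0"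
      using that by (auto simp: Z_def z c_def)
    obtain u v where K: "K = {u..v}" using tagged_cell_interval[OF p xK] by metis
    obtain u' v' where L: "L = {u'..v'}" using tagged_cell_interval[OF q yL] by metis
    have KL: "K \<inter> L = {max u u'..min v v'}" using K L by auto
    have "max u u' < min v v'"
      using nz unfolding KL increment_interval by (metis diff_self order_le_less)
    then show ?thesis using KL by (auto simp: z c_def)
  qed
  have inj: "inj_on c Z"
  proof (rule inj_onI)
    fix z z' assume zz: "z \<in> Z" "z' \<in> Z" "c z = c z'"
    obtain u v where uv: "c z = {u..v}" "u < v" using c_int[OF zz(1)] by blast
    define w where "w = (u + v)/2"
    have w: "w \<in> interior (c z)" using uv by (simp add: w_def)
    obtain x K y L where z: "z = ((x, K), (y, L))" by (metis surj_pair)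
    obtain x' K' y' L' where z': "z' = ((x', K'), (y', L'))" by (metis surj_pair)
    have "w \<in> interior (K \<inter> L)" "w \<in> interior (K' \<inter> L')"
      using w zz(3) unfolding z z' c_def by (simp_all only: fst_conv snd_conv)
    then have "w \<in> interior K" "w \<in> interior L" "w \<in> interior K'" "w \<in> interior L'"
      by simp_all
    moreover have "(x, K) \<in> p" "(y, L) \<in> q" "(x', K') \<in> p" "(y', L') \<in> q"
      using zz by (auto simp: z z' Z_def)
    ultimately have "(x, K) = (x', K')" "(y, L) = (y', L')"
      using tagged_division_ofD(5)[OF p, of x K x' K'] tagged_division_ofD(5)[OF q, of y L y' L']
      by blast+
    then show "z = z'" by (simp add: z z')
  qed
  have sub: "c ` Z \<subseteq> D"
  proof
    fix M assume "M \<in> c ` Z"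
    then obtain z where z: "z \<in> Z" "M = c z" by blast
    then have "M \<noteq> {}" using c_int[OF z(1)] by auto
    moreover have "snd (fst z) \<in> snd ` p" "snd (snd z) \<in> snd ` q" using z by (auto simp: Z_def)
    ultimately show "M \<in> D" unfolding D_def using z(2) c_def by blast
  qed
  have D_fin: "finite D" using D by auto
  have "(\<Sum>(x, K)\<in>p. \<Sum>(y, L)\<in>q. \<bar>increment A (K \<inter> L)\<bar>) = (\<Sum>z\<in>p \<times> q. \<bar>increment A (c z)\<bar>)"
    by (simp add: sum.cartesian_product case_prod_beta c_def)
  also have "\<dots> = (\<Sum>z\<in>Z. \<bar>increment A (c z)\<bar>)"
    by (rule sum.mono_neutral_right) (use fin in \<open>auto simp: Z_def\<close>)
  also have "\<dots> = (\<Sum>M\<in>c ` Z. \<bar>increment A M\<bar>)" by (simp add: sum.reindex[OF inj])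
  also have "\<dots> \<le> (\<Sum>M\<in>D. \<bar>increment A M\<bar>)" by (rule sum_mono2[OF D_fin sub]) auto
  also have "\<dots> = (\<Sum>M\<in>D. \<bar>A (Sup M) - A (Inf M)\<bar>)"
    by (rule sum.cong) (auto simp: D_def increment_def)
  also have "\<dots> \<le> B" by (rule B[OF D])
  finally show ?thesis .
qed

lemma rs_sum_refine:
  assumes p: "p tagged_division_of {a..b}" and q: "q tagged_division_of {a..b}" and "a \<le> b"
  shows "rs_sum h A p = (\<Sum>(x, K)\<in>p. \<Sum>(y, L)\<in>q. h x * increment A (K \<inter> L))"
proof (rule sum.cong)
  fix z assume "z \<in> p"
  moreover obtain x K where z: "z = (x, K)" by (metis surj_pair)
  ultimately have xK: "(x, K) \<in> p" by simp
  obtain u v where K: "K = {u..v}" "u \<le> x" "x \<le> v" "a \<le> u" "v \<le> b" using tagged_cell_interval[OF p xK] by metis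
  have "A (Sup K) - A (Inf K) = (\<Sum>(y, L)\<in>q. increment A (K \<inter> L))"
    using increment_split[OF q, of u v A] K \<open>a \<le> b\<close> by (simp add: increment_interval)
  then show "(case z of (x, K) \<Rightarrow> h x * (A (Sup K) - A (Inf K))) =
        (case z of (x, K) \<Rightarrow> \<Sum>(y, L)\<in>q. h x * increment A (K \<inter> L))"
    by (simp add: z sum_distrib_left case_prod_beta)
qed simp

text \<open>
  On the common refinement both sums use the same increments of \<open>A\<close>, with values of \<open>h\<close> taken at tags that
  are less than \<open>2 * d\<close> apart. The bound does not mention \<open>h\<close> beyond its modulus of continuity, so
  it is uniform over equicontinuous families of integrands.
\<close>

lemma rs_sum_diff_le:
  assumes p: "p tagged_division_of {a..b}" and q: "q tagged_division_of {a..b}" and ab: "a \<le> b"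
    and B: "\<And>D. D division_of {a..b} \<Longrightarrow> (\<Sum>K\<in>D. \<bar>A (Sup K) - A (Inf K)\<bar>) \<le> B"
    and mp: "\<forall>(x, K)\<in>p. Sup K - Inf K < d" and mq: "\<forall>(x, K)\<in>q. Sup K - Inf K < d"
    and h: "\<And>x y. x \<in> {a..b} \<Longrightarrow> y \<in> {a..b} \<Longrightarrow> \<bar>x - y\<bar> < 2 * d \<Longrightarrow> \<bar>h x - h y\<bar> \<le> e"
    and e: "e \<ge> 0"
  shows "\<bar>rs_sum h A p - rs_sum h A q\<bar> \<le> e * B"
proof -
  have "rs_sum h A q = (\<Sum>(x, K)\<in>p. \<Sum>(y, L)\<in>q. h y * increment A (K \<inter> L))"
    using sum.swap[of "\<lambda>z z'. h (fst z') * increment A (snd z \<inter> snd z')" q p]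
    unfolding rs_sum_refine[OF q p ab] case_prod_beta by (simp add: Int_commute)
  then have "rs_sum h A p - rs_sum h A q = (\<Sum>(x, K)\<in>p. \<Sum>(y, L)\<in>q. (h x - h y) * increment A (K \<inter> L))"
    unfolding rs_sum_refine[OF p q ab] by (simp add: case_prod_beta sum_subtractf algebra_simps)
  also have "\<bar>\<dots>\<bar> \<le> (\<Sum>(x, K)\<in>p. \<Sum>(y, L)\<in>q. e * \<bar>increment A (K \<inter> L)\<bar>)"
    unfolding case_prod_beta
  proof (intro order_trans[OF sum_abs] sum_mono)
    fix z z' assume "z \<in> p" "z' \<in> q"
    moreover obtain x K y L where z: "z = (x, K)" "z' = (y, L)" by (metis surj_pair)
    ultimately have xK: "(x, K) \<in> p" and yL: "(y, L) \<in> q" by auto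
    show "\<bar>(h (fst z) - h (fst z')) * increment A (snd z \<inter> snd z')\<bar> \<le> e * \<bar>increment A (snd z \<inter> snd z')\<bar>"
    proof (cases "K \<inter> L = {}")
      case True
      then show ?thesis by (simp add: z increment_def)
    next
      case False
      obtain u v where K: "K = {u..v}" "u \<le> x" "x \<le> v" "a \<le> u" "v \<le> b" using tagged_cell_interval[OF p xK] by metis
      obtain u' v' where L: "L = {u'..v'}" "u' \<le> y" "y \<le> v'" "a \<le> u'" "v' \<le> b" using tagged_cell_interval[OF q yL] by metis
      have "v - u < d" "v' - u' < d" using mp mq xK yL K L by auto
      moreover have "u \<le> v'" "u' \<le> v" using False K L by auto
      ultimately have "\<bar>x - y\<bar> < 2 * d" using K L by (simp add: abs_if)
      then have "\<bar>h x - h y\<bar> \<le> e" using K L by (intro h) auto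
      then show ?thesis by (simp add: z abs_mult mult_right_mono)
    qed
  qed
  also have "\<dots> = e * (\<Sum>(x, K)\<in>p. \<Sum>(y, L)\<in>q. \<bar>increment A (K \<inter> L)\<bar>)"
    by (simp add: case_prod_beta sum_distrib_left)
  also have "\<dots> \<le> e * B"
    by (rule mult_left_mono[OF sum_increment_refinement_le[OF p q B] e])
  finally show ?thesis .
qed

lemma fine_mesh_division_exists:
  assumes "d > 0"
  obtains p where "p tagged_division_of {a..b::real}" "\<forall>(x, K)\<in>p. Sup K - Inf K < d"
proof -
  have "gauge (\<lambda>x::real. ball x (d/3))" using assms by (simp add: gauge_def)
  then obtain p where p: "p tagged_division_of {a..b}" "(\<lambda>x. ball x (d/3)) fine p"
    by (rule fine_division_exists_real)
  have "Sup K - Inf K < d" if xK: "(x, K) \<in> p" for x K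
  proof -
    obtain u v where K: "K = {u..v}" "u \<le> x" "x \<le> v" by (rule tagged_cell_interval[OF p(1) xK])
    have "K \<subseteq> ball x (d/3)" using p(2) xK by (auto simp: fine_def)
    moreover have "u \<in> K" "v \<in> K" using K by auto
    ultimately have "u \<in> ball x (d/3)" "v \<in> ball x (d/3)" by blast+
    then have "v - u < d" using assms K by (auto simp: dist_real_def)
    then show ?thesis using K by simp
  qed
  then have "\<forall>(x, K)\<in>p. Sup K - Inf K < d" by blast
  then show ?thesis by (rule that[OF p(1)])
qed

lemma bounded_variation_onE:
  assumes "bounded_variation_on A a b"
  obtains B where "B > 0" "\<And>D. D division_of {a..b} \<Longrightarrow> (\<Sum>K\<in>D. \<bar>A (Sup K) - A (Inf K)\<bar>) \<le> B"
proof -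
  obtain B where "\<And>D. D division_of {a..b} \<Longrightarrow> (\<Sum>K\<in>D. \<bar>A (Sup K) - A (Inf K)\<bar>) \<le> B"
    using assms unfolding bounded_variation_on_def by blast
  then show ?thesis by (intro that[of "max B 1"]) (auto simp: le_max_iff_disj)
qed

text \<open>
  Completeness of the reals: the sums along divisions of mesh below \<open>1 / (n + 1)\<close> form a Cauchy sequence.
\<close>

lemma has_rs_integralI_cauchy:
  assumes "\<And>e. e > 0 \<Longrightarrow> \<exists>d>0. \<forall>p q. p tagged_division_of {a..b} \<and> q tagged_division_of {a..b} \<and>
      (\<forall>(x, K)\<in>p. Sup K - Inf K < d) \<and> (\<forall>(x, K)\<in>q. Sup K - Inf K < d) \<longrightarrow> \<bar>rs_sum h A p - rs_sum h A q\<bar> < e"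
  shows "\<exists>I. has_rs_integral h A a b I"
proof -
  have "\<forall>n. \<exists>p. p tagged_division_of {a..b} \<and> (\<forall>(x, K)\<in>p. Sup K - Inf K < 1 / (real n + 1))"
  proof
    fix n
    have "0 < 1 / (real n + 1)" by simp
    then obtain p where "p tagged_division_of {a..b}" "\<forall>(x, K)\<in>p. Sup K - Inf K < 1 / (real n + 1)"
      by (rule fine_mesh_division_exists)
    then show "\<exists>p. p tagged_division_of {a..b} \<and> (\<forall>(x, K)\<in>p. Sup K - Inf K < 1 / (real n + 1))"
      by (intro exI conjI)
  qed
  from choice[OF this] obtain P where P_all:
    "\<And>n. P n tagged_division_of {a..b} \<and> (\<forall>(x, K)\<in>P n. Sup K - Inf K < 1 / (real n + 1))" by blast
  then have P: "\<And>n. P n tagged_division_of {a..b}"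
    and Pm: "\<And>n x K. (x, K) \<in> P n \<Longrightarrow> Sup K - Inf K < 1 / (real n + 1)"
    by blast+
  have fine: "\<exists>N. \<forall>n\<ge>N. \<forall>(x, K)\<in>P n. Sup K - Inf K < d" if d: "d > 0" for d
  proof -
    obtain N :: nat where N: "1 / d < real N" using reals_Archimedean2 by blast
    have "Sup K - Inf K < d" if "n \<ge> N" "(x, K) \<in> P n" for n x K
    proof -
      have "1 / d < real n + 1" using N that(1) by linarith
      then have "1 / (real n + 1) < d" using d by (simp add: field_simps)
      then show ?thesis using Pm[OF that(2)] by linarith
    qed
    then show ?thesis by blast
  qed
  have "Cauchy (\<lambda>n. rs_sum h A (P n))"
  proof (rule metric_CauchyI)
    fix e :: real assume "e > 0"
    then obtain d where d: "d > 0" "\<And>p q. p tagged_division_of {a..b} \<Longrightarrow> q tagged_division_of {a..b} \<Longrightarrow>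
      (\<forall>(x, K)\<in>p. Sup K - Inf K < d) \<Longrightarrow> (\<forall>(x, K)\<in>q. Sup K - Inf K < d) \<Longrightarrow> \<bar>rs_sum h A p - rs_sum h A q\<bar> < e"
      using assms by meson
    obtain N where N: "\<And>n. n \<ge> N \<Longrightarrow> \<forall>(x, K)\<in>P n. Sup K - Inf K < d" using fine[OF d(1)] by blast
    show "\<exists>N. \<forall>m\<ge>N. \<forall>n\<ge>N. dist (rs_sum h A (P m)) (rs_sum h A (P n)) < e"
      unfolding dist_real_def using d(2)[OF P P N N] by blast
  qed
  then obtain I where I: "(\<lambda>n. rs_sum h A (P n)) \<longlonglongrightarrow> I"
    using Cauchy_convergent convergent_def by blast
  have "has_rs_integral h A a b I"
    unfolding has_rs_integral_def
  proof (intro allI impI)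
    fix e :: real assume "e > 0"
    then obtain d where d: "d > 0" "\<And>p q. p tagged_division_of {a..b} \<Longrightarrow> q tagged_division_of {a..b} \<Longrightarrow>
      (\<forall>(x, K)\<in>p. Sup K - Inf K < d) \<Longrightarrow> (\<forall>(x, K)\<in>q. Sup K - Inf K < d) \<Longrightarrow> \<bar>rs_sum h A p - rs_sum h A q\<bar> < e/2"
      using assms[of "e/2"] half_gt_zero by meson
    show "\<exists>d>0. \<forall>p. p tagged_division_of {a..b} \<longrightarrow> (\<forall>(x, K)\<in>p. Sup K - Inf K < d) \<longrightarrow> \<bar>rs_sum h A p - I\<bar> < e"
    proof (intro exI[of _ d] conjI allI impI d(1))
      fix p assume p: "p tagged_division_of {a..b}" "\<forall>(x, K)\<in>p. Sup K - Inf K < d"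
      obtain N1 where N1: "\<And>n. n \<ge> N1 \<Longrightarrow> \<forall>(x, K)\<in>P n. Sup K - Inf K < d" using fine[OF d(1)] by blast
      obtain N2 where N2: "\<And>n. n \<ge> N2 \<Longrightarrow> \<bar>rs_sum h A (P n) - I\<bar> < e/2"
        using LIMSEQ_D[OF I, of "e/2"] \<open>e > 0\<close> by auto
      define n where "n = max N1 N2"
      have "\<bar>rs_sum h A p - rs_sum h A (P n)\<bar> < e/2"
        by (rule d(2)[OF p(1) P p(2) N1]) (simp add: n_def)
      moreover have "\<bar>rs_sum h A (P n) - I\<bar> < e/2" by (rule N2) (simp add: n_def)
      ultimately show "\<bar>rs_sum h A p - I\<bar> < e" by (simp add: abs_if split: if_splits)
    qed
  qed
  then show ?thesis by blast
qed

lemma continuous_imp_has_rs_integral: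
  assumes A: "bounded_variation_on A a b" and ab: "a \<le> b" and h: "continuous_on {a..b} h"
  shows "has_rs_integral h A a b (rs_integral h A a b)"
proof -
  obtain B where B: "B > 0" "\<And>D. D division_of {a..b} \<Longrightarrow> (\<Sum>K\<in>D. \<bar>A (Sup K) - A (Inf K)\<bar>) \<le> B"
    using bounded_variation_onE[OF A] by blast
  have "\<exists>I. has_rs_integral h A a b I"
  proof (rule has_rs_integralI_cauchy)
    fix e :: real assume e: "e > 0"
    have "uniformly_continuous_on {a..b} h" using h by (intro compact_uniformly_continuous) auto
    then obtain d where d: "d > 0" "\<And>x y. x \<in> {a..b} \<Longrightarrow> y \<in> {a..b} \<Longrightarrow> dist x y < d \<Longrightarrow> dist (h x) (h y) < e/2/B"
      unfolding uniformly_continuous_on_def using e B(1) by (metis half_gt_zero divide_pos_pos)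
    have "\<bar>rs_sum h A p - rs_sum h A q\<bar> < e" if "p tagged_division_of {a..b}" "q tagged_division_of {a..b}"
      "\<forall>(x, K)\<in>p. Sup K - Inf K < d/2" "\<forall>(x, K)\<in>q. Sup K - Inf K < d/2" for p q
    proof -
      have "\<bar>rs_sum h A p - rs_sum h A q\<bar> \<le> e/2/B * B"
        by (rule rs_sum_diff_le[OF that(1,2) ab B(2) that(3,4)])
           (use d(2) e B(1) in \<open>force simp: dist_real_def\<close>)+
      then show ?thesis using e B(1) by simp
    qed
    then show "\<exists>d>0. \<forall>p q. p tagged_division_of {a..b} \<and> q tagged_division_of {a..b} \<and>
      (\<forall>(x, K)\<in>p. Sup K - Inf K < d) \<and> (\<forall>(x, K)\<in>q. Sup K - Inf K < d) \<longrightarrow> \<bar>rs_sum h A p - rs_sum h A q\<bar> < e"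
      using d(1) by (intro exI[of _ "d/2"]) auto
  qed
  then show ?thesis using rs_integral_unique by metis
qed

text \<open>
  The mesh needed for a given accuracy depends on the integrand only through its modulus of
  continuity, and the sections of \<open>G\<close> share one modulus on a compact parameter set.
\<close>

lemma rs_sum_uniform_approximation:
  fixes G :: "real \<Rightarrow> real \<Rightarrow> real"
  assumes A: "bounded_variation_on A a b" and ab: "a \<le> b" and e: "e > 0"
    and S: "compact S" and G: "continuous_on ({a..b} \<times> S) (\<lambda>(t, s). G t s)"
  obtains d where "d > 0" "\<And>p s. p tagged_division_of {a..b} \<Longrightarrow> \<forall>(x, K)\<in>p. Sup K - Inf K < d \<Longrightarrow> s \<in> S \<Longrightarrow>
     \<bar>rs_sum (\<lambda>t. G t s) A p - rs_integral (\<lambda>t. G t s) A a b\<bar> \<le> e"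
proof -
  obtain B where B: "B > 0" "\<And>D. D division_of {a..b} \<Longrightarrow> (\<Sum>K\<in>D. \<bar>A (Sup K) - A (Inf K)\<bar>) \<le> B"
    using bounded_variation_onE[OF A] by blast
  have "e/2/B > 0" using e B(1) by simp
  from uniform_modulus_on_compact_product[OF compact_Icc S G this]
  obtain d where d: "d > 0" and dG: "\<And>t s t' s'. \<lbrakk>t \<in> {a..b}; s \<in> S; t' \<in> {a..b}; s' \<in> S;
        \<bar>t - t'\<bar> < d; \<bar>s - s'\<bar> < d\<rbrakk> \<Longrightarrow> \<bar>G t s - G t' s'\<bar> < e/2/B"
    by blast
  show ?thesis
  proof (rule that[of "d/2"])
    fix p s assume p: "p tagged_division_of {a..b}" "\<forall>(x, K)\<in>p. Sup K - Inf K < d/2" and s: "s \<in> S"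
    have "continuous_on {a..b} (\<lambda>t. G t s)"
      using s by (intro continuous_on_along_graph[OF G] continuous_intros)
    from continuous_imp_has_rs_integral[OF A ab this]
    obtain d' where d': "d' > 0" "\<And>q. q tagged_division_of {a..b} \<Longrightarrow> \<forall>(x, K)\<in>q. Sup K - Inf K < d' \<Longrightarrow>
      \<bar>rs_sum (\<lambda>t. G t s) A q - rs_integral (\<lambda>t. G t s) A a b\<bar> < e/2"
      unfolding has_rs_integral_def using e by (meson half_gt_zero)
    have "min d' (d/2) > 0" using d d'(1) by simp
    then obtain q where q: "q tagged_division_of {a..b}" "\<forall>(x, K)\<in>q. Sup K - Inf K < min d' (d/2)"
      by (rule fine_mesh_division_exists)
    have "\<bar>rs_sum (\<lambda>t. G t s) A p - rs_sum (\<lambda>t. G t s) A q\<bar> \<le> e/2/B * B"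
    proof (rule rs_sum_diff_le[OF p(1) q(1) ab B(2) p(2)])
      fix x y assume "x \<in> {a..b}" "y \<in> {a..b}" "\<bar>x - y\<bar> < 2 * (d/2)"
      then show "\<bar>G x s - G y s\<bar> \<le> e/2/B"
        using dG[of x s y s] s d by simp
    qed (use q e B(1) in auto)
    moreover have "\<bar>rs_sum (\<lambda>t. G t s) A q - rs_integral (\<lambda>t. G t s) A a b\<bar> < e/2"
      by (rule d'(2)[OF q(1)]) (use q(2) in auto)
    ultimately show "\<bar>rs_sum (\<lambda>t. G t s) A p - rs_integral (\<lambda>t. G t s) A a b\<bar> \<le> e"
      using B(1) by (simp add: abs_if split: if_splits)
  qed (use d in simp)
qed

text \<open>
  The integral is a uniform limit of Riemann-Stieltjes sums over fixed divisions, and these are finite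
  combinations of continuous functions of the parameter.
\<close>

lemma continuous_on_rs_integral_parameter:
  fixes G :: "real \<Rightarrow> real \<Rightarrow> real"
  assumes A: "bounded_variation_on A a b" and ab: "a \<le> b"
    and S: "compact S" and G: "continuous_on ({a..b} \<times> S) (\<lambda>(t, s). G t s)"
  shows "continuous_on S (\<lambda>s. rs_integral (\<lambda>t. G t s) A a b)"
proof -
  have "\<exists>F. continuous_on S F \<and> (\<forall>s\<in>S. \<bar>F s - rs_integral (\<lambda>t. G t s) A a b\<bar> \<le> 1 / (real n + 1))" for n
  proof -
    obtain d where d: "d > 0" "\<And>p s. p tagged_division_of {a..b} \<Longrightarrow> \<forall>(x, K)\<in>p. Sup K - Inf K < d \<Longrightarrow> s \<in> S \<Longrightarrow>
       \<bar>rs_sum (\<lambda>t. G t s) A p - rs_integral (\<lambda>t. G t s) A a b\<bar> \<le> 1 / (real n + 1)"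
      by (rule rs_sum_uniform_approximation[OF A ab _ S G, of "1 / (real n + 1)"]) (simp, blast)
    obtain p where p: "p tagged_division_of {a..b}" "\<forall>(x, K)\<in>p. Sup K - Inf K < d"
      by (rule fine_mesh_division_exists[OF d(1)])
    have "continuous_on S (\<lambda>s. rs_sum (\<lambda>t. G t s) A p)"
      unfolding case_prod_beta
    proof (intro continuous_intros)
      fix z assume "z \<in> p"
      then have x: "fst z \<in> {a..b}"
        using tag_in_interval[OF p(1), of "fst z" "snd z"] by (cases z) auto
      show "continuous_on S (\<lambda>s. G (fst z) s)" by (rule continuous_on_section[OF G x])
    qed
    then show ?thesis using d(2)[OF p] by blast
  qed
  then obtain F where F: "\<And>n. continuous_on S (F n)"
    "\<And>n s. s \<in> S \<Longrightarrow> \<bar>F n s - rs_integral (\<lambda>t. G t s) A a b\<bar> \<le> 1 / (real n + 1)"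
    by metis
  have "uniform_limit S F (\<lambda>s. rs_integral (\<lambda>t. G t s) A a b) sequentially"
  proof (rule uniform_limitI)
    fix e :: real assume "e > 0"
    have "(\<lambda>n. 1 / (real n + 1)) \<longlonglongrightarrow> 0" by real_asymp
    then have "\<forall>\<^sub>F n in sequentially. 1 / (real n + 1) < e" using \<open>e > 0\<close> by (rule order_tendstoD)
    then show "\<forall>\<^sub>F n in sequentially. \<forall>s\<in>S. dist (F n s) (rs_integral (\<lambda>t. G t s) A a b) < e"
      by (rule eventually_mono) (use F(2) in \<open>auto simp: dist_real_def intro: le_less_trans\<close>)
  qed
  then show ?thesis
    by (rule uniform_limit_theorem[rotated]) (auto simp: F(1))
qed

text \<open>
  A Riemann-Stieltjes sum of the inner integral is the integral of a Riemann-Stieltjes sum, and the latter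
  converges uniformly in \<open>s\<close>. Existence of the outer integral is part of the conclusion.
\<close>

lemma rs_integral_fubini:
  fixes G :: "real \<Rightarrow> real \<Rightarrow> real"
  assumes A: "bounded_variation_on A a b" and ab: "a \<le> b" and cd: "c \<le> d"
    and G: "continuous_on ({a..b} \<times> {c..d}) (\<lambda>(t, s). G t s)" and y: "continuous_on {c..d} y"
  shows "has_rs_integral (\<lambda>t. integral {c..d} (\<lambda>s. G t s * y s)) A a b
           (integral {c..d} (\<lambda>s. rs_integral (\<lambda>t. G t s) A a b * y s))"
  unfolding has_rs_integral_def
proof (intro allI impI)
  fix e :: real assume e: "e > 0"
  define g where "g = (\<lambda>s. rs_integral (\<lambda>t. G t s) A a b)"
  have g: "continuous_on {c..d} g"
    unfolding g_def by (rule continuous_on_rs_integral_parameter[OF A ab _ G]) simp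
  define Y where "Y = integral {c..d} (\<lambda>s. \<bar>y s\<bar>)"
  have Y0: "Y \<ge> 0" unfolding Y_def by (intro integral_nonneg integrable_continuous_real continuous_intros y) auto
  define e' where "e' = e / (Y + 1)"
  have e': "e' > 0" "e' * Y < e" using e Y0 by (auto simp: e'_def field_simps)
  obtain m where m: "m > 0" "\<And>p s. p tagged_division_of {a..b} \<Longrightarrow> \<forall>(x, K)\<in>p. Sup K - Inf K < m \<Longrightarrow> s \<in> {c..d} \<Longrightarrow>
     \<bar>rs_sum (\<lambda>t. G t s) A p - g s\<bar> \<le> e'"
    unfolding g_def by (rule rs_sum_uniform_approximation[OF A ab e'(1) _ G]) (simp, blast)
  show "\<exists>m>0. \<forall>p. p tagged_division_of {a..b} \<longrightarrow> (\<forall>(x, K)\<in>p. Sup K - Inf K < m) \<longrightarrow>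
     \<bar>rs_sum (\<lambda>t. integral {c..d} (\<lambda>s. G t s * y s)) A p - integral {c..d} (\<lambda>s. rs_integral (\<lambda>t. G t s) A a b * y s)\<bar> < e"
  proof (intro exI[of _ m] conjI allI impI m(1))
    fix p assume p: "p tagged_division_of {a..b}" "\<forall>(x, K)\<in>p. Sup K - Inf K < m"
    have G_s: "continuous_on {c..d} (\<lambda>s. G (fst z) s)" if "z \<in> p" for z
    proof -
      have x: "fst z \<in> {a..b}"
        using tag_in_interval[OF p(1), of "fst z" "snd z"] that by (cases z) auto
      show ?thesis by (rule continuous_on_section[OF G x])
    qed
    have fin: "finite p" using p by auto
    have S_cont: "continuous_on {c..d} (\<lambda>s. rs_sum (\<lambda>t. G t s) A p)"
      unfolding case_prod_beta by (intro continuous_intros G_s)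
    have "rs_sum (\<lambda>t. integral {c..d} (\<lambda>s. G t s * y s)) A p =
        (\<Sum>z\<in>p. integral {c..d} (\<lambda>s. G (fst z) s * y s * (A (Sup (snd z)) - A (Inf (snd z)))))"
      by (simp add: case_prod_beta)
    also have "\<dots> = integral {c..d} (\<lambda>s. \<Sum>z\<in>p. G (fst z) s * y s * (A (Sup (snd z)) - A (Inf (snd z))))"
      by (intro integral_sum[symmetric] fin integrable_continuous_real continuous_intros G_s y)
    also have "\<dots> = integral {c..d} (\<lambda>s. rs_sum (\<lambda>t. G t s) A p * y s)"
      by (simp add: case_prod_beta sum_distrib_left sum_distrib_right mult_ac)
    finally have "rs_sum (\<lambda>t. integral {c..d} (\<lambda>s. G t s * y s)) A p - integral {c..d} (\<lambda>s. g s * y s)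
       = integral {c..d} (\<lambda>s. (rs_sum (\<lambda>t. G t s) A p - g s) * y s)"
      unfolding left_diff_distrib
      by (subst integral_diff) (auto intro!: integrable_continuous_real continuous_on_mult S_cont y g)
    also have "norm \<dots> \<le> integral {c..d} (\<lambda>s. e' * \<bar>y s\<bar>)"
    proof (rule integral_norm_bound_integral)
      fix s assume "s \<in> {c..d}"
      then show "norm ((rs_sum (\<lambda>t. G t s) A p - g s) * y s) \<le> e' * \<bar>y s\<bar>"
        using m(2)[OF p] by (simp add: abs_mult mult_right_mono)
    qed (intro integrable_continuous_real continuous_intros S_cont y g)+
    also have "\<dots> = e' * Y" by (simp add: Y_def)
    also have "\<dots> < e" by (rule e')
    finally show "\<bar>rs_sum (\<lambda>t. integral {c..d} (\<lambda>s. G t s * y s)) A p -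
        integral {c..d} (\<lambda>s. rs_integral (\<lambda>t. G t s) A a b * y s)\<bar> < e"
      by (simp add: g_def)
  qed
qed

lemma has_rs_integral_add_scaled:
  assumes "has_rs_integral f A a b I" "has_rs_integral g A a b J"
  shows "has_rs_integral (\<lambda>t. f t * k + g t) A a b (I * k + J)"
  unfolding has_rs_integral_def
proof (intro allI impI)
  fix e :: real assume e: "e > 0"
  define e' where "e' = e / (\<bar>k\<bar> + 1)"
  have e': "e' > 0" using e by (simp add: e'_def)
  have "e' * (\<bar>k\<bar> + 1) = e" by (simp add: e'_def)
  then have e'_eq: "e' * \<bar>k\<bar> + e' = e" by (simp add: distrib_left)
  obtain d1 where d1: "d1 > 0" "\<And>p. p tagged_division_of {a..b} \<Longrightarrow> \<forall>(x, K)\<in>p. Sup K - Inf K < d1 \<Longrightarrow>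
        \<bar>rs_sum f A p - I\<bar> < e'"
    using assms(1) e' unfolding has_rs_integral_def by meson
  obtain d2 where d2: "d2 > 0" "\<And>p. p tagged_division_of {a..b} \<Longrightarrow> \<forall>(x, K)\<in>p. Sup K - Inf K < d2 \<Longrightarrow>
        \<bar>rs_sum g A p - J\<bar> < e'"
    using assms(2) e' unfolding has_rs_integral_def by meson
  have tri: "\<bar>x * k + y - (I * k + J)\<bar> \<le> \<bar>x - I\<bar> * \<bar>k\<bar> + \<bar>y - J\<bar>" for x y
  proof -
    have "x * k + y - (I * k + J) = (x - I) * k + (y - J)" by (simp add: algebra_simps)
    then show ?thesis using abs_triangle_ineq[of "(x - I) * k" "y - J"] by (simp only: abs_mult)
  qed
  show "\<exists>d>0. \<forall>p. p tagged_division_of {a..b} \<longrightarrow> (\<forall>(x, K)\<in>p. Sup K - Inf K < d) \<longrightarrow>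
     \<bar>rs_sum (\<lambda>t. f t * k + g t) A p - (I * k + J)\<bar> < e"
  proof (intro exI[of _ "min d1 d2"] conjI allI impI)
    fix p assume p: "p tagged_division_of {a..b}" "\<forall>(x, K)\<in>p. Sup K - Inf K < min d1 d2"
    have 1: "\<bar>rs_sum f A p - I\<bar> < e'" by (rule d1(2)[OF p(1)]) (use p(2) in auto)
    have 2: "\<bar>rs_sum g A p - J\<bar> < e'" by (rule d2(2)[OF p(1)]) (use p(2) in auto)
    have "rs_sum (\<lambda>t. f t * k + g t) A p = rs_sum f A p * k + rs_sum g A p"
      unfolding case_prod_beta sum_distrib_right sum.distrib[symmetric]
      by (rule sum.cong) (simp_all add: algebra_simps)
    then have "\<bar>rs_sum (\<lambda>t. f t * k + g t) A p - (I * k + J)\<bar>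
        \<le> \<bar>rs_sum f A p - I\<bar> * \<bar>k\<bar> + \<bar>rs_sum g A p - J\<bar>"
      by (simp only: tri)
    also have "\<dots> < e' * \<bar>k\<bar> + e'" using 1 2 by (intro add_le_less_mono mult_right_mono) auto
    finally show "\<bar>rs_sum (\<lambda>t. f t * k + g t) A p - (I * k + J)\<bar> < e" using e'_eq by simp
  qed (use d1 d2 in auto)
qed

lemma has_rs_integral_cong:
  assumes "has_rs_integral f A a b I" "\<And>t. t \<in> {a..b} \<Longrightarrow> g t = f t"
  shows "has_rs_integral g A a b I"
proof -
  have "rs_sum g A p = rs_sum f A p" if "p tagged_division_of {a..b}" for p
  proof (rule sum.cong)
    fix z assume "z \<in> p"
    then have "fst z \<in> {a..b}" using tag_in_interval[OF that, of "fst z" "snd z"] by (cases z) auto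
    then show "(case z of (x, K) \<Rightarrow> g x * (A (Sup K) - A (Inf K))) = (case z of (x, K) \<Rightarrow> f x * (A (Sup K) - A (Inf K)))"
      by (simp add: case_prod_beta assms(2))
  qed simp
  then show ?thesis using assms(1) by (simp add: has_rs_integral_def cong: imp_cong)
qed

section \<open>Fractional integrals\<close>

text \<open>
  The substitution \<open>r = s + (t - s) * x\<close> reduces this to Euler's first integral.
\<close>

lemma Beta_kernel_integral:
  assumes "\<mu> > 0" "\<nu> > 0" "s < t"
  shows "((\<lambda>r. (t - r) powr (\<mu> - 1) * (r - s) powr (\<nu> - 1)) has_integral
           (t - s) powr (\<mu> + \<nu> - 1) * Beta \<mu> \<nu>) {s..t::real}"
proof -
  have m: "t - s > 0" using assms by simp
  have "((\<lambda>x. (t - s) powr (\<mu> + \<nu> - 2) * (x powr (\<nu> - 1) * (1 - x) powr (\<mu> - 1))) has_integral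
      (t - s) powr (\<mu> + \<nu> - 2) * Beta \<nu> \<mu>) {0..1}"
    by (intro has_integral_mult_right has_integral_Beta_real assms)
  also have "?this \<longleftrightarrow> ((\<lambda>x. (t - ((t - s) *\<^sub>R x + s)) powr (\<mu> - 1) * ((t - s) *\<^sub>R x + s - s) powr (\<nu> - 1))
      has_integral (t - s) powr (\<mu> + \<nu> - 2) * Beta \<nu> \<mu>) {0..1}"
  proof (rule has_integral_cong)
    fix x :: real assume x: "x \<in> {0..1}"
    have "t - ((t - s) *\<^sub>R x + s) = (t - s) * (1 - x)" by (simp add: algebra_simps)
    moreover have "(t - s) powr (\<mu> + \<nu> - 2) = (t - s) powr (\<mu> - 1) * (t - s) powr (\<nu> - 1)"
      by (simp flip: powr_add)
    ultimately show "(t - s) powr (\<mu> + \<nu> - 2) * (x powr (\<nu> - 1) * (1 - x) powr (\<mu> - 1)) =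
      (t - ((t - s) *\<^sub>R x + s)) powr (\<mu> - 1) * ((t - s) *\<^sub>R x + s - s) powr (\<nu> - 1)"
      using x m by (simp add: powr_mult mult_ac)
  qed
  also have "(t - s) powr (\<mu> + \<nu> - 2) * Beta \<nu> \<mu> = ((t - s) powr (\<mu> + \<nu> - 1) * Beta \<mu> \<nu>) /\<^sub>R (t - s) ^ DIM(real)"
    using m powr_mult_base[of "t - s" "\<mu> + \<nu> - 2"] by (simp add: Beta_commute field_simps)
  also have "{0..1} = cbox ((s - s) /\<^sub>R (t - s)) ((t - s) /\<^sub>R (t - s))" using m by simp
  finally show ?thesis
    unfolding has_integral_affinity_iff[OF m, where f = "\<lambda>r. (t - r) powr (\<mu> - 1) * (r - s) powr (\<nu> - 1)"]
    by (simp only: cbox_interval)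
qed

lemma power_kernel_integral:
  assumes "\<nu> > 0"
  shows "((\<lambda>x. (1 - x) powr (\<nu> - 1)) has_integral 1 / \<nu>) {0..1::real}"
proof -
  have "((\<lambda>x::real. x powr (\<nu> - 1)) has_integral 1 / \<nu>) (cbox 0 1)"
    using has_integral_powr_from_0[of "\<nu> - 1" 1] assms by simp
  from has_integral_affinity[OF this, of "-1" 1]
  show ?thesis by (simp add: image_affinity_atLeastAtMost_diff algebra_simps image_diff_atLeastAtMost[where d=1 for d])
qed

text \<open>
  Covers weights with an integrable singularity, such as the kernel of a fractional integral
  of order below 1.
\<close>

lemma weighted_integrable:
  fixes k g :: "real \<Rightarrow> real"
  assumes "k integrable_on {0..1}" "\<And>x. x \<in> {0..1} \<Longrightarrow> k x \<ge> 0" "continuous_on {0..1} g"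
  shows "(\<lambda>x. k x * g x) integrable_on {0..1}"
proof -
  have "(\<lambda>x. g x * k x) absolutely_integrable_on {0..1}"
  proof (rule absolutely_integrable_bounded_measurable_product_real)
    show "g \<in> borel_measurable (lebesgue_on {0..1})"
      by (intro continuous_imp_measurable_on_sets_lebesgue assms) auto
    show "bounded (g ` {0..1})" by (intro compact_imp_bounded compact_continuous_image assms) auto
    show "k absolutely_integrable_on {0..1}" by (intro nonnegative_absolutely_integrable_1 assms)
  qed auto
  then show ?thesis by (simp add: mult.commute absolutely_integrable_on_def)
qed

text \<open>
  Rescaling to \<open>[0, 1]\<close> moves the dependence on \<open>t\<close> out of the singular kernel.
\<close>

lemma kernel_has_integral:
  fixes y :: "real \<Rightarrow> real"
  assumes \<nu>: "\<nu> > 0" and y: "continuous_on {0..1} y" and t: "t \<in> {0..1}"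
  shows "((\<lambda>s. (t - s) powr (\<nu> - 1) * y s) has_integral
           t powr \<nu> * integral {0..1} (\<lambda>x. (1 - x) powr (\<nu> - 1) * y (t * x))) {0..t}"
proof (cases "t = 0")
  case True
  then show ?thesis using has_integral_refl(1)[of _ "0::real"] by simp
next
  case False
  then have m: "t > 0" using t by simp
  have y_t: "continuous_on {0..1} (\<lambda>x. y (t * x))"
    by (rule continuous_on_compose2[OF y]) (use t in \<open>auto intro!: continuous_intros mult_le_one\<close>)
  define J where "J = integral {0..1} (\<lambda>x. (1 - x) powr (\<nu> - 1) * y (t * x))"
  have "(\<lambda>x. (1 - x) powr (\<nu> - 1) * y (t * x)) integrable_on {0..1}"
    using power_kernel_integral[OF \<nu>] by (intro weighted_integrable y_t) auto
  then have "((\<lambda>x. t powr (\<nu> - 1) * ((1 - x) powr (\<nu> - 1) * y (t * x))) has_integral t powr (\<nu> - 1) * J) {0..1}"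
    unfolding J_def by (intro has_integral_mult_right integrable_integral)
  also have "?this \<longleftrightarrow> ((\<lambda>x. (t - (t *\<^sub>R x + 0)) powr (\<nu> - 1) * y (t *\<^sub>R x + 0)) has_integral t powr (\<nu> - 1) * J) {0..1}"
  proof (rule has_integral_cong)
    fix x :: real assume x: "x \<in> {0..1}"
    have "t - (t *\<^sub>R x + 0) = t * (1 - x)" by (simp add: algebra_simps)
    then show "t powr (\<nu> - 1) * ((1 - x) powr (\<nu> - 1) * y (t * x)) = (t - (t *\<^sub>R x + 0)) powr (\<nu> - 1) * y (t *\<^sub>R x + 0)"
      using x m by (simp add: powr_mult)
  qed
  also have "t powr (\<nu> - 1) * J = (t powr \<nu> * J) /\<^sub>R t ^ DIM(real)"
    using m powr_mult_base[of t "\<nu> - 1"] by (simp add: field_simps)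
  also have "{0..1} = cbox ((0 - 0) /\<^sub>R t) ((t - 0) /\<^sub>R t)" using m by simp
  finally show ?thesis
    unfolding has_integral_affinity_iff[OF m, where f = "\<lambda>s. (t - s) powr (\<nu> - 1) * y s"]
    by (simp only: cbox_interval J_def)
qed

lemma rl_integral_pos:
  assumes "\<nu> > 0"
  shows "rl_integral \<nu> y t = 1 / Gamma \<nu> * integral {0..t} (\<lambda>s. (t - s) powr (\<nu> - 1) * y s)"
  using assms by (simp add: rl_integral_def)

text \<open>
  In the rescaled form the kernel is a fixed integrable weight, so uniform continuity of \<open>y\<close> suffices.
\<close>

lemma continuous_on_rl_integral:
  assumes \<nu>: "\<nu> > 0" and y: "continuous_on {0..1} y"
  shows "continuous_on {0..1} (rl_integral \<nu> y)"
proof -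
  define F where "F = (\<lambda>t. integral {0..1} (\<lambda>x. (1 - x) powr (\<nu> - 1) * y (t * x)))"
  have y_t: "continuous_on {0..1} (\<lambda>x. y (t * x))" if "t \<in> {0..1}" for t
    by (rule continuous_on_compose2[OF y]) (use that in \<open>auto intro!: continuous_intros mult_le_one\<close>)
  have int: "(\<lambda>x. (1 - x) powr (\<nu> - 1) * y (t * x)) integrable_on {0..1}" if "t \<in> {0..1}" for t
    using power_kernel_integral[OF \<nu>] by (intro weighted_integrable y_t that) auto
  have "continuous_on {0..1} F"
    unfolding continuous_on_iff
  proof (intro ballI allI impI)
    fix t e :: real assume t: "t \<in> {0..1}" and e: "e > 0"
    have "uniformly_continuous_on {0..1} y" using y by (intro compact_uniformly_continuous) auto
    moreover have "e * \<nu> / 2 > 0" using e \<nu> by simp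
    ultimately obtain d where d: "d > 0" and dy: "\<And>x x'. x \<in> {0..1} \<Longrightarrow> x' \<in> {0..1} \<Longrightarrow> dist x' x < d \<Longrightarrow> dist (y x') (y x) < e * \<nu> / 2"
      unfolding uniformly_continuous_on_def by meson
    have "dist (F t') (F t) < e" if t': "t' \<in> {0..1}" "dist t' t < d" for t'
    proof -
      have F_diff: "F t' - F t = integral {0..1} (\<lambda>x. (1 - x) powr (\<nu> - 1) * y (t' * x) - (1 - x) powr (\<nu> - 1) * y (t * x))"
        unfolding F_def by (rule integral_diff[symmetric]) (intro int t t')+
      have "norm (F t' - F t) \<le> integral {0..1} (\<lambda>x. (1 - x) powr (\<nu> - 1) * (e * \<nu> / 2))"
        unfolding F_diff
      proof (rule integral_norm_bound_integral)
        show "(\<lambda>x. (1 - x) powr (\<nu> - 1) * y (t' * x) - (1 - x) powr (\<nu> - 1) * y (t * x)) integrable_on {0..1}"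
          by (intro integrable_diff int t t')
        show "(\<lambda>x. (1 - x) powr (\<nu> - 1) * (e * \<nu> / 2)) integrable_on {0..1}"
          using has_integral_mult_left[OF power_kernel_integral[OF \<nu>]] by blast
        fix x :: real assume x: "x \<in> {0..1}"
        have "\<bar>t' * x - t * x\<bar> = \<bar>t' - t\<bar> * x" using x by (simp add: abs_mult flip: left_diff_distrib)
        also have "\<dots> \<le> \<bar>t' - t\<bar> * 1" using x by (intro mult_left_mono) auto
        finally have "dist (t' * x) (t * x) < d" using t' by (simp add: dist_real_def)
        then have "\<bar>y (t' * x) - y (t * x)\<bar> \<le> e * \<nu> / 2"
          using dy[of "t * x" "t' * x"] x t t' by (simp add: dist_real_def mult_le_one)
        then show "norm ((1 - x) powr (\<nu> - 1) * y (t' * x) - (1 - x) powr (\<nu> - 1) * y (t * x))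
           \<le> (1 - x) powr (\<nu> - 1) * (e * \<nu> / 2)"
          unfolding right_diff_distrib[symmetric] real_norm_def abs_mult by (intro mult_mono) auto
      qed
      also have "\<dots> = 1 / \<nu> * (e * \<nu> / 2)"
        by (simp add: integral_unique[OF power_kernel_integral[OF \<nu>]])
      also have "\<dots> < e" using e \<nu> by simp
      finally show ?thesis by (simp add: dist_real_def)
    qed
    then show "\<exists>d>0. \<forall>t'\<in>{0..1}. dist t' t < d \<longrightarrow> dist (F t') (F t) < e" using d by blast
  qed
  moreover have "continuous_on {0..1} (\<lambda>t::real. t powr \<nu>)"
    using \<nu> by (intro continuous_on_powr' continuous_intros) auto
  ultimately have "continuous_on {0..1} (\<lambda>t. 1 / Gamma \<nu> * (t powr \<nu> * F t))"
    by (intro continuous_on_mult continuous_on_const)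
  then show ?thesis
    by (rule continuous_on_eq) (simp add: rl_integral_pos[OF \<nu>] integral_unique[OF kernel_has_integral[OF \<nu> y]] F_def)
qed

lemma rl_integral_nonneg:
  assumes \<nu>: "\<nu> > 0" and y: "continuous_on {0..1} y" "\<And>s. s \<in> {0..1} \<Longrightarrow> y s \<ge> 0" and t: "t \<in> {0..1}"
  shows "rl_integral \<nu> y t \<ge> 0"
proof -
  have "0 \<le> integral {0..t} (\<lambda>s. (t - s) powr (\<nu> - 1) * y s)"
    by (rule integral_nonneg[OF has_integral_integrable[OF kernel_has_integral[OF \<nu> y(1) t]]]) (use t y(2) in auto)
  then show ?thesis using \<nu> by (simp add: rl_integral_pos)
qed

text \<open>
  The form to which Tonelli's theorem applies. The factor \<open>indicator {0..1}\<close> makes the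
  integrand Borel measurable on the whole line.
\<close>

lemma rl_integral_nn_integral:
  assumes \<nu>: "\<nu> > 0" and y: "continuous_on {0..1} y" "\<And>s. s \<in> {0..1} \<Longrightarrow> y s \<ge> 0" and t: "t \<in> {0..1}"
  shows "(\<integral>\<^sup>+s. ennreal (indicator {0..t} s * (t - s) powr (\<nu> - 1) * (indicator {0..1} s * y s)) \<partial>lborel)
           = ennreal (Gamma \<nu> * rl_integral \<nu> y t)"
proof -
  have "((\<lambda>s. (t - s) powr (\<nu> - 1) * y s) has_integral Gamma \<nu> * rl_integral \<nu> y t) {0..t}"
    using kernel_has_integral[OF \<nu> y(1) t] Gamma_real_pos[OF \<nu>]
    by (simp add: rl_integral_pos[OF \<nu>] integral_unique)
  from nn_integral_has_integral_lebesgue[OF _ this]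
  have "(\<integral>\<^sup>+s. ennreal (indicator {0..t} s * ((t - s) powr (\<nu> - 1) * y s)) \<partial>lborel) = ennreal (Gamma \<nu> * rl_integral \<nu> y t)"
    using y(2) t by simp
  also have "(\<integral>\<^sup>+s. ennreal (indicator {0..t} s * ((t - s) powr (\<nu> - 1) * y s)) \<partial>lborel) =
      (\<integral>\<^sup>+s. ennreal (indicator {0..t} s * (t - s) powr (\<nu> - 1) * (indicator {0..1} s * y s)) \<partial>lborel)"
    using t by (intro nn_integral_cong) (auto simp: indicator_def)
  finally show ?thesis .
qed

text \<open>
  Exchanging the order of integration leaves the inner integral of \<open>Beta_kernel_integral\<close>, and
  \<open>Beta \<mu> \<nu> = Gamma \<mu> * Gamma \<nu> / Gamma (\<mu> + \<nu>)\<close>. Nonnegativity of \<open>y\<close> lets Tonelli's theorem do this without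
  any integrability check on the product space.
\<close>

lemma rl_integral_semigroup:
  assumes \<mu>: "\<mu> > 0" and \<nu>: "\<nu> > 0" and y: "continuous_on {0..1} y" "\<And>s. s \<in> {0..1} \<Longrightarrow> y s \<ge> 0"
    and t: "t \<in> {0..1}"
  shows "rl_integral \<mu> (rl_integral \<nu> y) t = rl_integral (\<mu> + \<nu>) y t"
proof -
  define Y where "Y = (\<lambda>s. indicator {0..1} s * y s)"
  have [measurable]: "Y \<in> borel_measurable borel"
    using borel_measurable_continuous_on_indicator[of "{0..1}" y] y(1) by (simp add: Y_def)
  have Y0: "Y s \<ge> 0" for s using y(2) by (simp add: Y_def indicator_def)
  define H where "H = (\<lambda>r s. indicator {0..t} r * (t - r) powr (\<mu> - 1) * (indicator {0..r} s * (r - s) powr (\<nu> - 1) * Y s))"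
  have ind: "indicator {0..r} s = (if 0 \<le> s \<and> s \<le> r then 1 else (0::real))" for r s :: real
    by (simp add: indicator_def)
  have [measurable]: "(\<lambda>(r, s). ennreal (H r s)) \<in> borel_measurable (lborel \<Otimes>\<^sub>M lborel)"
    unfolding H_def ind by measurable
  have G: "Gamma \<mu> > 0" "Gamma \<nu> > 0" "Gamma (\<mu> + \<nu>) > 0" using \<mu> \<nu> by auto
  have B: "Beta \<mu> \<nu> * Gamma (\<mu> + \<nu>) = Gamma \<mu> * Gamma \<nu>" using G by (simp add: Beta_def)
  have B0: "Beta \<mu> \<nu> \<ge> 0" using G by (simp add: Beta_def)
  have "ennreal (Gamma \<mu> * Gamma \<nu> * rl_integral \<mu> (rl_integral \<nu> y) t) =
      ennreal (Gamma \<nu>) * ennreal (Gamma \<mu> * rl_integral \<mu> (rl_integral \<nu> y) t)"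
    using G by (simp add: mult_ac flip: ennreal_mult')
  also have "\<dots> = ennreal (Gamma \<nu>) * (\<integral>\<^sup>+r. ennreal (indicator {0..t} r * (t - r) powr (\<mu> - 1) * (indicator {0..1} r * rl_integral \<nu> y r)) \<partial>lborel)"
    by (subst rl_integral_nn_integral[OF \<mu> continuous_on_rl_integral[OF \<nu> y(1)] _ t]) (auto intro!: rl_integral_nonneg \<nu> y)
  also have "\<dots> = (\<integral>\<^sup>+r. ennreal (Gamma \<nu>) * ennreal (indicator {0..t} r * (t - r) powr (\<mu> - 1) * (indicator {0..1} r * rl_integral \<nu> y r)) \<partial>lborel)"
  proof (rule nn_integral_cmult[symmetric])
    have [measurable]: "(\<lambda>r. indicator {0..1} r * rl_integral \<nu> y r) \<in> borel_measurable borel"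
      using borel_measurable_continuous_on_indicator[of "{0..1}" "rl_integral \<nu> y"] continuous_on_rl_integral[OF \<nu> y(1)] by simp
    show "(\<lambda>r. ennreal (indicator {0..t} r * (t - r) powr (\<mu> - 1) * (indicator {0..1} r * rl_integral \<nu> y r))) \<in> borel_measurable lborel"
      by measurable
  qed
  also have "\<dots> = (\<integral>\<^sup>+r. \<integral>\<^sup>+s. ennreal (H r s) \<partial>lborel \<partial>lborel)"
  proof (intro nn_integral_cong)
    fix r :: real
    show "ennreal (Gamma \<nu>) * ennreal (indicator {0..t} r * (t - r) powr (\<mu> - 1) * (indicator {0..1} r * rl_integral \<nu> y r))
        = (\<integral>\<^sup>+s. ennreal (H r s) \<partial>lborel)"
    proof (cases "r \<in> {0..t}")
      case True
      then have r: "r \<in> {0..1}" using t by auto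
      have "(\<integral>\<^sup>+s. ennreal (H r s) \<partial>lborel) =
          (\<integral>\<^sup>+s. ennreal ((t - r) powr (\<mu> - 1)) * ennreal (indicator {0..r} s * (r - s) powr (\<nu> - 1) * Y s) \<partial>lborel)"
        using True by (intro nn_integral_cong) (simp add: H_def flip: ennreal_mult')
      also have "\<dots> = ennreal ((t - r) powr (\<mu> - 1)) * (\<integral>\<^sup>+s. ennreal (indicator {0..r} s * (r - s) powr (\<nu> - 1) * Y s) \<partial>lborel)"
        by (rule nn_integral_cmult) measurable
      also have "\<dots> = ennreal ((t - r) powr (\<mu> - 1)) * ennreal (Gamma \<nu> * rl_integral \<nu> y r)"
        unfolding Y_def by (subst rl_integral_nn_integral[OF \<nu> y r]) auto
      finally show ?thesis using True r G rl_integral_nonneg[OF \<nu> y r]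
        by (simp add: mult_ac flip: ennreal_mult)
    qed (simp add: H_def)
  qed
  also have "\<dots> = (\<integral>\<^sup>+s. \<integral>\<^sup>+r. ennreal (H r s) \<partial>lborel \<partial>lborel)"
    by (rule lborel_pair.Fubini'[symmetric]) measurable
  also have "\<dots> = (\<integral>\<^sup>+s. ennreal (Beta \<mu> \<nu>) * ennreal (indicator {0..t} s * (t - s) powr (\<mu> + \<nu> - 1) * Y s) \<partial>lborel)"
  proof (intro nn_integral_cong)
    fix s :: real
    show "(\<integral>\<^sup>+r. ennreal (H r s) \<partial>lborel) = ennreal (Beta \<mu> \<nu>) * ennreal (indicator {0..t} s * (t - s) powr (\<mu> + \<nu> - 1) * Y s)"
    proof (cases "0 \<le> s \<and> s < t")
      case True
      have "(\<integral>\<^sup>+r. ennreal (H r s) \<partial>lborel) =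
          (\<integral>\<^sup>+r. ennreal (Y s) * ennreal (indicator {s..t} r * ((t - r) powr (\<mu> - 1) * (r - s) powr (\<nu> - 1))) \<partial>lborel)"
        using True Y0 by (intro nn_integral_cong) (auto simp: H_def indicator_def mult_ac simp flip: ennreal_mult')
      also have "\<dots> = ennreal (Y s) * (\<integral>\<^sup>+r. ennreal (indicator {s..t} r * ((t - r) powr (\<mu> - 1) * (r - s) powr (\<nu> - 1))) \<partial>lborel)"
        by (rule nn_integral_cmult) measurable
      also have "\<dots> = ennreal (Y s) * ennreal ((t - s) powr (\<mu> + \<nu> - 1) * Beta \<mu> \<nu>)"
        using True by (subst nn_integral_has_integral_lebesgue[OF _ Beta_kernel_integral[OF \<mu> \<nu>]]) auto
      finally show ?thesis using True Y0 B0 by (simp add: mult_ac flip: ennreal_mult')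
    next
      case False
      have "H r s = 0" for r
      proof (cases "0 \<le> s \<and> s \<le> r \<and> r \<le> t")
        case True
        then have "r = s" using False by auto
        then show ?thesis by (simp add: H_def)
      qed (auto simp: H_def indicator_def)
      then show ?thesis using False by (auto simp: indicator_def)
    qed
  qed
  also have "\<dots> = ennreal (Beta \<mu> \<nu>) * (\<integral>\<^sup>+s. ennreal (indicator {0..t} s * (t - s) powr (\<mu> + \<nu> - 1) * Y s) \<partial>lborel)"
    by (rule nn_integral_cmult) measurable
  also have "\<dots> = ennreal (Beta \<mu> \<nu>) * ennreal (Gamma (\<mu> + \<nu>) * rl_integral (\<mu> + \<nu>) y t)"
    unfolding Y_def by (subst rl_integral_nn_integral[OF _ y t]) (use \<mu> \<nu> in auto)
  also have "\<dots> = ennreal (Gamma \<mu> * Gamma \<nu> * rl_integral (\<mu> + \<nu>) y t)"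
    using B0 B by (simp add: mult.assoc[symmetric] flip: ennreal_mult')
  finally have "Gamma \<mu> * Gamma \<nu> * rl_integral \<mu> (rl_integral \<nu> y) t = Gamma \<mu> * Gamma \<nu> * rl_integral (\<mu> + \<nu>) y t"
    using G \<mu> \<nu> by (subst (asm) ennreal_inj)
      (auto intro!: mult_nonneg_nonneg rl_integral_nonneg continuous_on_rl_integral y t)
  then show ?thesis using G by simp
qed

lemma rl_integral_1: "rl_integral 1 v t = integral {0..t} v"
proof -
  have "integral {0..t} (\<lambda>s. (t - s) powr (1 - 1) * v s) = integral {0..t} v"
    by (rule integral_spike[of "{t}"]) auto
  then show ?thesis by (simp add: rl_integral_def)
qed

lemma has_real_derivative_transform:
  assumes "t \<in> S" "\<And>x. x \<in> S \<Longrightarrow> g x = f x" "(f has_real_derivative d) (at t within S)"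
  shows "(g has_real_derivative d) (at t within S)"
  by (rule has_field_derivative_transform_within[OF assms(3) zero_less_one assms(1)]) (simp add: assms(2))

text \<open>
  By the semigroup law the integral of order \<open>1 + \<nu>\<close> is the ordinary integral of the continuous function
  \<open>rl_integral \<nu> y\<close>.
\<close>

lemma rl_integral_has_derivative:
  assumes \<nu>: "\<nu> > 0" and y: "continuous_on {0..1} y" "\<And>s. s \<in> {0..1} \<Longrightarrow> y s \<ge> 0" and t: "t \<in> {0..1}"
  shows "(rl_integral (1 + \<nu>) y has_real_derivative rl_integral \<nu> y t) (at t within {0..1})"
proof -
  have 1: "((\<lambda>t. integral {0..t} (rl_integral \<nu> y)) has_real_derivative rl_integral \<nu> y t) (at t within {0..1})"
    by (rule integral_has_real_derivative[OF continuous_on_rl_integral[OF \<nu> y(1)] t])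
  have 2: "rl_integral (1 + \<nu>) y x = integral {0..x} (rl_integral \<nu> y)" if "x \<in> {0..1}" for x
    using rl_integral_semigroup[OF zero_less_one \<nu> y that] by (simp add: rl_integral_1)
  show ?thesis by (rule has_real_derivative_transform[OF t 2 1])
qed

lemma deriv01_eq:
  assumes t: "t \<in> {0..1}" and u: "(u has_real_derivative d) (at t within {0..1})"
  shows "deriv01 u t = d"
  unfolding deriv01_def
  by (rule vector_derivative_within_closed_interval[OF zero_less_one t])
     (rule u[unfolded has_real_derivative_iff_has_vector_derivative])

lemma C2_on01I:
  assumes u: "\<And>t. t \<in> {0..1} \<Longrightarrow> (u has_real_derivative u' t) (at t within {0..1})"
    and u': "\<And>t. t \<in> {0..1} \<Longrightarrow> (u' has_real_derivative u'' t) (at t within {0..1})"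
    and u'': "continuous_on {0..1} u''"
  shows "C2_on01 u" and "\<And>t. t \<in> {0..1} \<Longrightarrow> deriv01 (deriv01 u) t = u'' t"
proof -
  have 1: "deriv01 u t = u' t" if "t \<in> {0..1}" for t using deriv01_eq[OF that u[OF that]] .
  have d: "(deriv01 u has_real_derivative u'' t) (at t within {0..1})" if "t \<in> {0..1}" for t
    by (rule has_real_derivative_transform[OF that _ u'[OF that]]) (simp add: 1)
  show 2: "deriv01 (deriv01 u) t = u'' t" if "t \<in> {0..1}" for t using deriv01_eq[OF that d[OF that]] .
  have "continuous_on {0..1} (deriv01 (deriv01 u))" by (rule continuous_on_eq[OF u'']) (simp add: 2)
  moreover have "u differentiable_on {0..1}" "deriv01 u differentiable_on {0..1}"
    using u d unfolding differentiable_on_def real_differentiable_def by blast+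
  ultimately show "C2_on01 u" by (simp add: C2_on01_def)
qed

text \<open>
  Differentiating twice lowers the order of the fractional integral by 2, so \<open>u''\<close> is
  \<open>- rl_integral (\<alpha> - 2) y\<close>, which vanishes at 0. Integrating it to the order \<open>3 - \<alpha>\<close> gives minus the ordinary
  integral of \<open>y\<close>. For \<open>\<alpha> = 3\<close> the integral of order 0 is the identity and has to be treated apart.
\<close>

lemma caputo_problem_solution:
  assumes \<alpha>: "2 < \<alpha>" "\<alpha> \<le> 3" and y: "continuous_on {0..1} y" "\<And>s. s \<in> {0..1} \<Longrightarrow> y s \<ge> 0"
    and u: "\<And>t. t \<in> {0..1} \<Longrightarrow> u t = C * t - rl_integral \<alpha> y t"
  shows "C2_on01 u" and "deriv01 (deriv01 u) 0 = 0"
    and "\<And>t. t \<in> {0<..<1} \<Longrightarrow> has_caputo_derivative \<alpha> u (- y t) t"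
proof -
  have d1: "(u has_real_derivative C - rl_integral (\<alpha> - 1) y t) (at t within {0..1})" if t: "t \<in> {0..1}" for t
  proof -
    have *: "((\<lambda>t. C * t - rl_integral (1 + (\<alpha> - 1)) y t) has_real_derivative C * 1 - rl_integral (\<alpha> - 1) y t) (at t within {0..1})"
      by (rule DERIV_diff[OF DERIV_cmult[OF DERIV_ident] rl_integral_has_derivative[OF _ y t]]) (use \<alpha> in auto)
    show ?thesis using has_real_derivative_transform[OF t _ *, of u] by (simp add: u)
  qed
  have d2: "((\<lambda>t. C - rl_integral (\<alpha> - 1) y t) has_real_derivative - rl_integral (\<alpha> - 2) y t) (at t within {0..1})"
    if t: "t \<in> {0..1}" for t
  proof -
    have "((\<lambda>t. C - rl_integral (1 + (\<alpha> - 2)) y t) has_real_derivative 0 - rl_integral (\<alpha> - 2) y t) (at t within {0..1})"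
      by (rule DERIV_diff[OF DERIV_const rl_integral_has_derivative[OF _ y t]]) (use \<alpha> in auto)
    then show ?thesis by simp
  qed
  have c: "continuous_on {0..1} (\<lambda>t. - rl_integral (\<alpha> - 2) y t)"
    by (intro continuous_intros continuous_on_rl_integral y) (use \<alpha> in auto)
  show "C2_on01 u" by (rule C2_on01I(1)[OF d1 d2 c])
  have u'': "deriv01 (deriv01 u) t = - rl_integral (\<alpha> - 2) y t" if "t \<in> {0..1}" for t
    by (rule C2_on01I(2)[OF d1 d2 c that])
  show z: "deriv01 (deriv01 u) 0 = 0" using u''[of 0] \<alpha> by (simp add: rl_integral_def)
  have I: "rl_integral (3 - \<alpha>) (\<lambda>s. deriv01 (deriv01 u) s - deriv01 (deriv01 u) 0) t = - integral {0..t} y"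
    if t: "t \<in> {0..1}" for t
  proof (cases "\<alpha> = 3")
    case True
    have "rl_integral (3 - \<alpha>) (\<lambda>s. deriv01 (deriv01 u) s - deriv01 (deriv01 u) 0) t = deriv01 (deriv01 u) t"
      using True z by (simp add: rl_integral_def)
    also have "\<dots> = - rl_integral 1 y t" using u''[OF t] True by simp
    finally show ?thesis by (simp add: rl_integral_1)
  next
    case False
    then have a3: "3 - \<alpha> > 0" and a2: "\<alpha> - 2 > 0" using \<alpha> by auto
    have "rl_integral (3 - \<alpha>) (\<lambda>s. deriv01 (deriv01 u) s - deriv01 (deriv01 u) 0) t
        = 1 / Gamma (3 - \<alpha>) * integral {0..t} (\<lambda>s. - ((t - s) powr (3 - \<alpha> - 1) * rl_integral (\<alpha> - 2) y s))"
      unfolding rl_integral_pos[OF a3] z using t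
      by (intro arg_cong[where f = "\<lambda>x. _ * x"] Henstock_Kurzweil_Integration.integral_cong) (simp add: u'')
    also have "\<dots> = - rl_integral (3 - \<alpha>) (rl_integral (\<alpha> - 2) y) t"
      by (simp add: rl_integral_pos[OF a3])
    also have "\<dots> = - rl_integral 1 y t"
      using rl_integral_semigroup[OF a3 a2 y t] by simp
    finally show ?thesis by (simp add: rl_integral_1)
  qed
  fix t :: real assume "t \<in> {0<..<1}"
  then have t: "t \<in> {0..1}" and int: "t \<in> interior {0..1}" by auto
  have "((\<lambda>t. - integral {0..t} y) has_real_derivative - y t) (at t within {0..1})"
    by (rule DERIV_minus[OF integral_has_real_derivative[OF y(1) t]])
  from has_real_derivative_transform[OF t I this]
  have "(rl_integral (3 - \<alpha>) (\<lambda>s. deriv01 (deriv01 u) s - deriv01 (deriv01 u) 0) has_real_derivative - y t) (at t within {0..1})" .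
  then show "has_caputo_derivative \<alpha> u (- y t) t"
    unfolding has_caputo_derivative_def at_within_interior[OF int] .
qed

section \<open>The Green function\<close>

text \<open>
  Replacing the case distinction by a maximum makes continuity evident; it relies on \<open>0 powr a = 0\<close>.
\<close>

lemma green_eq:
  "green \<alpha> t s = t * Psi \<alpha> s - max (t - s) 0 powr (\<alpha> - 1) / Gamma \<alpha>"
  by (auto simp: green_def Psi_def diff_divide_distrib max_def)

lemma continuous_on_Psi: "1 < \<alpha> \<Longrightarrow> continuous_on {0..1} (Psi \<alpha>)"
proof -
  assume \<alpha>: "1 < \<alpha>"
  then have "Gamma \<alpha> \<noteq> 0" using Gamma_real_pos[of \<alpha>] by linarith
  with \<alpha> show ?thesis unfolding Psi_def by (intro continuous_intros continuous_on_powr') auto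
qed

lemma Psi_nonneg: "0 < \<alpha> \<Longrightarrow> 0 \<le> Psi \<alpha> s"
  unfolding Psi_def by (intro divide_nonneg_nonneg) auto

lemma Psi_integral: "0 < \<alpha> \<Longrightarrow> (Psi \<alpha> has_integral 1 / Gamma (\<alpha> + 1)) {0..1}"
proof -
  assume \<alpha>: "0 < \<alpha>"
  then have "\<alpha> \<notin> \<int>\<^sub>\<le>\<^sub>0" by (auto elim!: nonpos_Ints_cases)
  then have "Gamma (\<alpha> + 1) = \<alpha> * Gamma \<alpha>" by (rule Gamma_plus1)
  then show ?thesis
    using has_integral_divide[OF power_kernel_integral[OF \<alpha>], of "Gamma \<alpha>"] by (simp add: Psi_def[abs_def])
qed

lemma continuous_on_green:
  assumes "1 < \<alpha>"
  shows "continuous_on ({0..1} \<times> {0..1}) (\<lambda>(t, s). green \<alpha> t s)"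
proof -
  have G: "Gamma \<alpha> \<noteq> 0" using Gamma_real_pos[of \<alpha>] assms by linarith
  show ?thesis
    unfolding green_eq Psi_def case_prod_beta
    by (intro continuous_intros continuous_on_powr') (use assms G in auto)
qed

lemma green_le:
  assumes "0 < \<alpha>" "t \<in> {0..1}"
  shows "green \<alpha> t s \<le> Psi \<alpha> s"
proof -
  have "t * Psi \<alpha> s \<le> 1 * Psi \<alpha> s" using assms Psi_nonneg[OF assms(1)] by (intro mult_right_mono) auto
  moreover have "0 \<le> max (t - s) 0 powr (\<alpha> - 1) / Gamma \<alpha>" using assms by (intro divide_nonneg_nonneg) auto
  ultimately show ?thesis by (simp add: green_eq)
qed

text \<open>
  On \<open>[0, 1]\<close> one has \<open>t - s \<le> t * (1 - s)\<close>, and the power of the right-hand side factorises.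
\<close>

lemma green_ge:
  assumes \<alpha>: "1 < \<alpha>" and t: "t \<in> {0..1}" and s: "s \<in> {0..1}"
  shows "(t - t powr (\<alpha> - 1)) * Psi \<alpha> s \<le> green \<alpha> t s"
proof -
  have "t * s \<le> 1 * s" "t * s \<le> t * 1" using t s by (intro mult_right_mono mult_left_mono; simp)+
  then have "max (t - s) 0 powr (\<alpha> - 1) \<le> (t * (1 - s)) powr (\<alpha> - 1)"
    using t s \<alpha> by (intro powr_mono2) (auto simp: algebra_simps)
  also have "\<dots> = t powr (\<alpha> - 1) * (1 - s) powr (\<alpha> - 1)" using t s by (simp add: powr_mult)
  finally have "max (t - s) 0 powr (\<alpha> - 1) / Gamma \<alpha> \<le> t powr (\<alpha> - 1) * Psi \<alpha> s"
    using \<alpha> by (simp add: Psi_def divide_right_mono)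
  then show ?thesis by (simp add: green_eq algebra_simps)
qed

lemma powr_gap:
  assumes "2 < \<alpha>" "t \<in> {0..1::real}"
  shows "0 \<le> t - t powr (\<alpha> - 1)" "t - t powr (\<alpha> - 1) \<le> t"
  using assms powr_mono'[of 1 "\<alpha> - 1" t] by auto

lemma powr_gap_pos:
  assumes "2 < \<alpha>" "0 < t" "t < (1::real)"
  shows "0 < t - t powr (\<alpha> - 1)"
  using assms powr_less_mono'[of t 1 "\<alpha> - 1"] by auto

text \<open>
  So \<open>green \<alpha>\<close> is the Green function of the problem with the boundary values \<open>u 0 = u'' 0 = u 1 = 0\<close>.
\<close>

lemma green_integral:
  assumes \<alpha>: "1 < \<alpha>" and y: "continuous_on {0..1} y" and t: "t \<in> {0..1}"
  shows "((\<lambda>s. green \<alpha> t s * y s) has_integral t * rl_integral \<alpha> y 1 - rl_integral \<alpha> y t) {0..1}"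
proof -
  have \<alpha>0: "\<alpha> > 0" using \<alpha> by simp
  have G: "Gamma \<alpha> \<noteq> 0" using Gamma_real_pos[OF \<alpha>0] by simp
  have rl: "((\<lambda>s. (r - s) powr (\<alpha> - 1) * y s / Gamma \<alpha>) has_integral rl_integral \<alpha> y r) {0..r}" if "r \<in> {0..1}" for r
    using has_integral_divide[OF kernel_has_integral[OF \<alpha>0 y that], of "Gamma \<alpha>"]
    by (simp add: rl_integral_pos[OF \<alpha>0] integral_unique[OF kernel_has_integral[OF \<alpha>0 y that]])
  have "((\<lambda>s. max (t - s) 0 powr (\<alpha> - 1) * y s / Gamma \<alpha>) has_integral rl_integral \<alpha> y t) {0..t}"
    using rl[OF t] by (rule has_integral_eq[rotated]) auto
  then have "((\<lambda>s. if s \<in> {0..t} then max (t - s) 0 powr (\<alpha> - 1) * y s / Gamma \<alpha> else 0) has_integral rl_integral \<alpha> y t) {0..1}"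
    using t by (subst has_integral_restrict) auto
  then have 1: "((\<lambda>s. max (t - s) 0 powr (\<alpha> - 1) * y s / Gamma \<alpha>) has_integral rl_integral \<alpha> y t) {0..1}"
    by (rule has_integral_eq[rotated]) auto
  have "((\<lambda>s. t * ((1 - s) powr (\<alpha> - 1) * y s / Gamma \<alpha>) - max (t - s) 0 powr (\<alpha> - 1) * y s / Gamma \<alpha>)
     has_integral t * rl_integral \<alpha> y 1 - rl_integral \<alpha> y t) {0..1}"
    by (intro has_integral_diff has_integral_mult_right rl 1) simp
  then show ?thesis by (simp add: green_eq Psi_def algebra_simps)
qed

section \<open>Existence of a positive solution\<close>

theorem theorem3p1:
  fixes \<alpha> \<eta> \<mu> \<beta> :: real and A :: "real \<Rightarrow> real" and f :: "real \<Rightarrow> real \<Rightarrow> real"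
  assumes "2 < \<alpha>" "\<alpha> \<le> 3" and "\<eta> \<in> {0<..<1}" and "\<mu> \<ge> 0" and "\<beta> \<ge> 0"
    and "bounded_variation_on A 0 1"
    and "0 \<le> Lam \<eta> \<mu> \<beta> A" "Lam \<eta> \<mu> \<beta> A < 1"
    and "\<forall>s\<in>{0..1}. g_fun \<alpha> A s \<ge> 0"
    and "continuous_on ({0..1} \<times> {0..}) (\<lambda>(t, x). f t x)"
    and "\<forall>t\<in>{0..1}. \<forall>x\<ge>0. f t x \<ge> 0"
    and C1: "\<exists>a\<in>{0<..<inverse (tau2 \<alpha> \<eta> \<mu> \<beta> A)}. \<exists>c>0.
               \<forall>t\<in>{0..1}. \<forall>x\<ge>0. f t x \<le> a * x + c"
    and C2: "\<exists>b\<ge>inverse (tau1 \<alpha> \<eta> \<mu> \<beta> A). \<exists>\<delta>>0.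
               \<forall>t\<in>{0..1}. \<forall>x\<in>{0..\<delta>}. f t x \<ge> b * x"
  shows "\<exists>u. positive_bvp_solution \<alpha> \<eta> \<mu> \<beta> A f u"
proof -
  note \<alpha> = \<open>2 < \<alpha>\<close> \<open>\<alpha> \<le> 3\<close> and \<mu> = \<open>\<mu> \<ge> 0\<close> and \<beta> = \<open>\<beta> \<ge> 0\<close> and BV = \<open>bounded_variation_on A 0 1\<close>
  have \<alpha>1: "1 < \<alpha>" "0 < \<alpha>" using \<alpha> by auto
  have \<eta>: "\<eta> \<in> {0..1}" "0 < \<eta>" "\<eta> < 1" using \<open>\<eta> \<in> {0<..<1}\<close> by auto
  define L where "L = Lam \<eta> \<mu> \<beta> A"
  have L: "0 \<le> L" "1 - L > 0" using assms(7,8) by (auto simp: L_def)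
  define g where "g = g_fun \<alpha> A"
  have g0: "0 \<le> g s" if "s \<in> {0..1}" for s using assms(9) that by (simp add: g_def)
  have g: "continuous_on {0..1} g"
    unfolding g_def g_fun_def[abs_def]
    by (rule continuous_on_rs_integral_parameter[OF BV _ _ continuous_on_green[OF \<alpha>1(1)]]) auto
  have Psi: "continuous_on {0..1} (Psi \<alpha>)" by (rule continuous_on_Psi[OF \<alpha>1(1)])
  have Psi0: "0 \<le> Psi \<alpha> s" for s by (rule Psi_nonneg[OF \<alpha>1(2)])
  define \<Phi> where "\<Phi> = (\<lambda>s. 1 / (1 - L) * (\<beta> * g s + (\<mu> - L + 1) * Psi \<alpha> s))"
  define e where "e = \<eta> - \<eta> powr (\<alpha> - 1)"
  define c where "c = (\<lambda>t. e * (t - t powr (\<alpha> - 1)))"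
  define K where "K = (\<lambda>t s. t / (1 - L) * (\<mu> * green \<alpha> \<eta> s + \<beta> * g s) + green \<alpha> t s)"
  have e: "0 < e" "e \<le> 1" using powr_gap_pos[OF \<alpha>(1) \<eta>(2,3)] \<eta> powr_ge_zero[of \<eta> "\<alpha> - 1"]
    unfolding e_def by linarith+
  have \<Phi>: "continuous_on {0..1} \<Phi>" unfolding \<Phi>_def by (intro continuous_intros g Psi)
  have c: "continuous_on {0..1} c" unfolding c_def
    by (intro continuous_intros continuous_on_powr') (use \<alpha> in auto)
  have c0: "0 \<le> c t" if "t \<in> {0..1}" for t using powr_gap[OF \<alpha>(1) that] e by (simp add: c_def)
  have \<Phi>0: "0 \<le> \<Phi> s" if "s \<in> {0..1}" for s
  proof -
    have "0 \<le> \<mu> - L + 1" using L \<mu> by simp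
    then have "0 \<le> \<beta> * g s + (\<mu> - L + 1) * Psi \<alpha> s"
      using mult_nonneg_nonneg[OF \<beta> g0[OF that]] mult_nonneg_nonneg[OF _ Psi0, of "\<mu> - L + 1" s] by linarith
    then show ?thesis using L by (simp add: \<Phi>_def)
  qed
  have green_K: "continuous_on ({0..1} \<times> {0..1}) (\<lambda>(t, s). K t s)"
  proof -
    have "continuous_on ({0..1} \<times> {0..1}) (\<lambda>z. green \<alpha> (fst z) (snd z))"
      using continuous_on_green[OF \<alpha>1(1)] by (simp add: case_prod_beta)
    moreover have "continuous_on ({0..1} \<times> {0..1}) (\<lambda>z::real \<times> real. green \<alpha> \<eta> (snd z))"
      by (rule continuous_on_compose2[OF continuous_on_section[OF continuous_on_green[OF \<alpha>1(1)] \<eta>(1)]])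
         (auto intro!: continuous_intros)
    moreover have "continuous_on ({0..1} \<times> {0..1}) (\<lambda>z::real \<times> real. g (snd z))"
      by (rule continuous_on_compose2[OF g]) (auto intro!: continuous_intros)
    ultimately show ?thesis
      unfolding K_def case_prod_beta using L by (intro continuous_intros) auto
  qed
  \<comment> \<open>the summand \<open>1 - L\<close> hidden in \<open>\<mu> - L + 1\<close> accounts for the second part of \<open>K\<close>\<close>
  have \<Phi>_split: "\<Phi> s = 1 / (1 - L) * (\<mu> * Psi \<alpha> s + \<beta> * g s) + Psi \<alpha> s" for s
    using L by (simp add: \<Phi>_def field_simps)
  have K_up: "K t s \<le> \<Phi> s" if t: "t \<in> {0..1}" and s: "s \<in> {0..1}" for t s
  proof -
    have "\<mu> * green \<alpha> \<eta> s + \<beta> * g s \<le> \<mu> * Psi \<alpha> s + \<beta> * g s"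
      using green_le[OF \<alpha>1(2) \<eta>(1)] \<mu> by (simp add: mult_left_mono)
    moreover have "0 \<le> \<mu> * Psi \<alpha> s + \<beta> * g s" using \<mu> \<beta> Psi0 g0[OF s] by simp
    moreover have "0 \<le> t / (1 - L)" "t / (1 - L) \<le> 1 / (1 - L)" using t L by (auto intro: divide_right_mono)
    ultimately have "t / (1 - L) * (\<mu> * green \<alpha> \<eta> s + \<beta> * g s) \<le> 1 / (1 - L) * (\<mu> * Psi \<alpha> s + \<beta> * g s)"
      by (meson mult_left_mono mult_right_mono order_trans)
    then show ?thesis using green_le[OF \<alpha>1(2) t, of s] by (simp add: K_def \<Phi>_split)
  qed
  have K_lo: "c t * \<Phi> s \<le> K t s" if t: "t \<in> {0..1}" and s: "s \<in> {0..1}" for t s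
  proof -
    define q where "q = t - t powr (\<alpha> - 1)"
    have q: "0 \<le> q" "q \<le> t" using powr_gap[OF \<alpha>(1) t] by (auto simp: q_def)
    have eq: "e * q \<le> q" using q e by (simp add: mult_left_le_one_le)
    have "e * Psi \<alpha> s \<le> green \<alpha> \<eta> s" using green_ge[OF \<alpha>1(1) \<eta>(1) s] by (simp add: e_def)
    then have 1: "t * (\<mu> * (e * Psi \<alpha> s)) \<le> t * (\<mu> * green \<alpha> \<eta> s)"
      using t \<mu> by (intro mult_left_mono) auto
    have "q * (\<mu> * (e * Psi \<alpha> s)) \<le> t * (\<mu> * (e * Psi \<alpha> s))"
      using q \<mu> e Psi0 by (intro mult_right_mono) auto
    moreover have "(e * q) * (\<beta> * g s) \<le> t * (\<beta> * g s)"
      using q eq \<beta> g0[OF s] by (intro mult_right_mono) auto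
    ultimately have "e * q * (\<mu> * Psi \<alpha> s + \<beta> * g s) \<le> t * (\<mu> * green \<alpha> \<eta> s + \<beta> * g s)"
      using 1 by (simp add: algebra_simps)
    then have "e * q * (\<mu> * Psi \<alpha> s + \<beta> * g s) / (1 - L) \<le> t * (\<mu> * green \<alpha> \<eta> s + \<beta> * g s) / (1 - L)"
      using L by (intro divide_right_mono) auto
    moreover have "e * q * Psi \<alpha> s \<le> green \<alpha> t s"
      using mult_right_mono[OF eq Psi0, of s] green_ge[OF \<alpha>1(1) t s] by (simp add: q_def)
    moreover have "c t * \<Phi> s = e * q * (\<mu> * Psi \<alpha> s + \<beta> * g s) / (1 - L) + e * q * Psi \<alpha> s"
      by (simp add: c_def q_def \<Phi>_split distrib_left add_divide_distrib)
    ultimately show ?thesis by (simp add: K_def)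
  qed
  have tau2: "tau2 \<alpha> \<eta> \<mu> \<beta> A = integral {0..1} \<Phi>"
  proof -
    have "(\<Phi> has_integral 1 / (1 - L) * (\<beta> * integral {0..1} g + (\<mu> - L + 1) * (1 / Gamma (\<alpha> + 1)))) {0..1}"
      unfolding \<Phi>_def
      by (rule has_integral_mult_right[OF has_integral_add[OF
            has_integral_mult_right[OF integrable_integral[OF integrable_continuous_real[OF g]]]
            has_integral_mult_right[OF Psi_integral[OF \<alpha>1(2)]]]])
    then show ?thesis by (simp add: integral_unique tau2_def g_def L_def)
  qed
  have tau1: "tau1 \<alpha> \<eta> \<mu> \<beta> A = integral {0..1} (\<lambda>t. c t * \<Phi> t)"
  proof -
    have "integral {0..1} (\<lambda>t. c t * \<Phi> t) =
        integral {0..1} (\<lambda>s. e / (1 - L) * ((s - s powr (\<alpha> - 1)) * (\<beta> * g s + (\<mu> - L + 1) * Psi \<alpha> s)))"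
      by (simp add: c_def \<Phi>_def mult_ac)
    then show ?thesis by (simp add: tau1_def e_def g_def L_def)
  qed
  have tau1_pos: "tau1 \<alpha> \<eta> \<mu> \<beta> A > 0"
  proof -
    have cont: "continuous_on {0..1} (\<lambda>t. c t * \<Phi> t)" by (intro continuous_intros c \<Phi>)
    have nonneg: "0 \<le> c t * \<Phi> t" if "t \<in> {0..1}" for t by (intro mult_nonneg_nonneg c0 \<Phi>0 that)
    have "c (1/2) > 0" unfolding c_def using powr_gap_pos[OF \<alpha>(1), of "1/2"] e by simp
    moreover have "\<Phi> (1/2) > 0"
    proof -
      have "Psi \<alpha> (1/2) > 0" unfolding Psi_def using \<alpha>1 by simp
      moreover have "0 \<le> \<beta> * g (1/2)" using \<beta> g0[of "1/2"] by simp
      moreover have "\<mu> - L + 1 > 0" using L \<mu> by simp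
      ultimately have "\<beta> * g (1/2) + (\<mu> - L + 1) * Psi \<alpha> (1/2) > 0" by (metis add_nonneg_pos mult_pos_pos)
      then show ?thesis using L by (simp add: \<Phi>_def)
    qed
    ultimately have "c (1/2) * \<Phi> (1/2) \<noteq> 0" by simp
    then have "integral {0..1} (\<lambda>t. c t * \<Phi> t) \<noteq> 0"
      using integral_eq_0_iff[OF cont, of] nonneg by (auto dest!: bspec[of _ _ "1/2"])
    moreover have "integral {0..1} (\<lambda>t. c t * \<Phi> t) \<ge> 0"
      by (intro integral_nonneg integrable_continuous_real cont nonneg)
    ultimately show ?thesis by (simp add: tau1)
  qed
  obtain a m where a: "0 < a" "a < inverse (tau2 \<alpha> \<eta> \<mu> \<beta> A)" and m: "m > 0"
    and f_up: "\<And>t x. t \<in> {0..1} \<Longrightarrow> x \<ge> 0 \<Longrightarrow> f t x \<le> a * x + m"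
    using C1 by auto
  obtain b \<delta> where b: "b \<ge> inverse (tau1 \<alpha> \<eta> \<mu> \<beta> A)" and \<delta>: "\<delta> > 0"
    and f_lo: "\<And>t x. t \<in> {0..1} \<Longrightarrow> x \<in> {0..\<delta>} \<Longrightarrow> b * x \<le> f t x"
    using C2 by blast
  have a\<tau>: "a * integral {0..1} \<Phi> < 1"
  proof -
    have "tau2 \<alpha> \<eta> \<mu> \<beta> A > 0" using a by (metis inverse_positive_iff_positive less_trans)
    then show ?thesis using a(2) by (simp add: tau2 field_simps)
  qed
  have b\<tau>: "b * integral {0..1} (\<lambda>t. c t * \<Phi> t) \<ge> 1" "b \<ge> 0"
  proof -
    show "b * integral {0..1} (\<lambda>t. c t * \<Phi> t) \<ge> 1"
      using b tau1_pos by (simp add: tau1 field_simps)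
    show "b \<ge> 0" using b tau1_pos by (meson inverse_nonnegative_iff_nonnegative less_imp_le order_trans)
  qed
  obtain u where u: "continuous_on {0..1} u" and u0: "\<And>t. t \<in> {0..1} \<Longrightarrow> 0 \<le> u t"
    and u_ne: "\<exists>t\<in>{0..1}. u t \<noteq> 0"
    and u_fix: "\<And>t. t \<in> {0..1} \<Longrightarrow> u t = integral {0..1} (\<lambda>s. K t s * f s (u s))"
    by (rule hammerstein_positive_fixed_point[OF green_K \<Phi> c c0 K_up K_lo \<Phi>0 assms(10) _ f_up _ a\<tau> _ f_lo \<delta> b\<tau>])
       (use assms(11) a m in auto)
  define y where "y = (\<lambda>s. f s (u s))"
  have y: "continuous_on {0..1} y"
    unfolding y_def by (rule continuous_on_along_graph[OF assms(10)]) (auto intro!: continuous_intros u u0)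
  have y0: "y s \<ge> 0" if "s \<in> {0..1}" for s using assms(11) u0[OF that] that by (simp add: y_def)
  define Y where "Y = integral {0..1} (\<lambda>s. g s * y s)"
  define Z where "Z = (\<lambda>t. integral {0..1} (\<lambda>s. green \<alpha> t s * y s))"
  have green_int: "((\<lambda>s. green \<alpha> t s * y s) has_integral Z t) {0..1}" if "t \<in> {0..1}" for t
    unfolding Z_def by (rule integrable_integral[OF has_integral_integrable[OF green_integral[OF \<alpha>1(1) y that]]])
  have gy_int: "((\<lambda>s. g s * y s) has_integral Y) {0..1}"
    unfolding Y_def by (intro integrable_integral integrable_continuous_real continuous_intros g y)
  \<comment> \<open>\<open>M\<close> is the value at 1, since \<open>green \<alpha> 1\<close> vanishes\<close>
  define M where "M = 1 / (1 - L) * (\<mu> * Z \<eta> + \<beta> * Y)"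
  have u_eq: "u t = t * M + Z t" if t: "t \<in> {0..1}" for t
  proof -
    have "((\<lambda>s. t / (1 - L) * (\<mu> * (green \<alpha> \<eta> s * y s) + \<beta> * (g s * y s)) + green \<alpha> t s * y s)
       has_integral t / (1 - L) * (\<mu> * Z \<eta> + \<beta> * Y) + Z t) {0..1}"
      by (rule has_integral_add[OF has_integral_mult_right[OF has_integral_add[OF
            has_integral_mult_right[OF green_int[OF \<eta>(1)]] has_integral_mult_right[OF gy_int]]] green_int[OF t]])
    also have "(\<lambda>s. t / (1 - L) * (\<mu> * (green \<alpha> \<eta> s * y s) + \<beta> * (g s * y s)) + green \<alpha> t s * y s) = (\<lambda>s. K t s * y s)"
      by (simp add: K_def fun_eq_iff algebra_simps)
    finally show ?thesis using u_fix[OF t] by (simp add: integral_unique y_def M_def)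
  qed
  have u_rl: "u t = (M + rl_integral \<alpha> y 1) * t - rl_integral \<alpha> y t" if t: "t \<in> {0..1}" for t
    using u_eq[OF t] integral_unique[OF green_integral[OF \<alpha>1(1) y t]] by (simp add: Z_def algebra_simps)
  \<comment> \<open>interchanging the integrals turns the Stieltjes functional of the Green part into \<open>\<integral>g * y\<close>\<close>
  have gamma: "gamma_fun A u = rs_integral (\<lambda>t. t) A 0 1 * M + Y"
    unfolding gamma_fun_def
  proof (rule rs_integral_unique[OF has_rs_integral_cong[OF _ u_eq]])
    have "has_rs_integral Z A 0 1 Y"
      unfolding Z_def Y_def g_def g_fun_def
      by (rule rs_integral_fubini[OF BV _ _ continuous_on_green[OF \<alpha>1(1)] y]) auto
    then show "has_rs_integral (\<lambda>t. t * M + Z t) A 0 1 (rs_integral (\<lambda>t. t) A 0 1 * M + Y)"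
      by (intro has_rs_integral_add_scaled continuous_imp_has_rs_integral[OF BV]) (auto intro: continuous_intros)
  qed
  have "u 1 = M"
    using u_rl[of 1] by simp
  also have "M = \<mu> * u \<eta> + \<beta> * gamma_fun A u"
  proof -
    have "\<mu> * u \<eta> + \<beta> * gamma_fun A u = L * M + (\<mu> * Z \<eta> + \<beta> * Y)"
      by (simp add: u_eq[OF \<eta>(1)] gamma L_def Lam_def algebra_simps)
    also have "\<mu> * Z \<eta> + \<beta> * Y = (1 - L) * M" using L by (simp add: M_def)
    finally show ?thesis by (simp add: algebra_simps)
  qed
  finally have bc: "u 1 = \<mu> * u \<eta> + \<beta> * gamma_fun A u" .
  have "C2_on01 u" "deriv01 (deriv01 u) 0 = 0"
    by (rule caputo_problem_solution(1)[OF \<alpha> y y0 u_rl] caputo_problem_solution(2)[OF \<alpha> y y0 u_rl]; assumption)+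
  moreover have "u 0 = 0" using u_rl[of 0] \<alpha>1 by (simp add: rl_integral_pos)
  moreover have "\<exists>d. has_caputo_derivative \<alpha> u d t \<and> d + f t (u t) = 0" if "t \<in> {0<..<1}" for t
  proof (intro exI conjI)
    show "has_caputo_derivative \<alpha> u (- y t) t" by (rule caputo_problem_solution(3)[OF \<alpha> y y0 u_rl that])
    show "- y t + f t (u t) = 0" by (simp add: y_def)
  qed
  ultimately have "bvp_solution \<alpha> \<eta> \<mu> \<beta> A f u"
    using bc by (simp add: bvp_solution_def)
  then show ?thesis using u0 u_ne unfolding positive_bvp_solution_def by (intro exI[of _ u] conjI ballI)
qed

end
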